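(* Let $n\ge1$, and for $r=1,2$ let $\vec{\alpha_r}=(\alpha_{r1},\dots,\alpha_{rn})$ with all $\alpha_{ri}>0$, $\vec{p_r}=(p_{r1},\dots,p_{rn})$ with all $0<p_{ri}<1$, and $\vec{\beta_r}=(\beta_{r1},\dots,\beta_{rn})$ with all $\beta_{ri}>0$. Let $\mathcal{N}_r=\sum_{i=1}^n N_{\alpha_{ri},p_{ri}}$ and $\mathcal{G}_r=\sum_{i=1}^n G_{\alpha_{ri},\beta_{ri}}$, sums of independent negative binomial, resp. gamma, random variables. Then: (a) If $(\vec{\alpha_2},\vec{p_2})=^a((\vec{\alpha_2})_\uparrow,(\vec{p_2})_\downarrow)$, $\vec{\alpha_1}\prec_w\vec{\alpha_2}$ and $\log\vec{p_1}\prec^w\log\vec{p_2}$, then $\mathcal{N}_1\le_{st}\mathcal{N}_2$. (b) If $(\vec{\alpha_2},\vec{\beta_2})=^a((\vec{\alpha_2})_\uparrow,(\vec{\beta_2})_\downarrow)$, $\vec{\alpha_1}\prec_w\vec{\alpha_2}$ and $\log\vec{\beta_1}\prec^w\log\vec{\beta_2}$, then $\mathcal{G}_1\le_{st}\mathcal{G}_2$.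
   Context: For $\alpha>0$, $0<p<1$, $q=1-p$: $P(N_{\alpha,p}=k)=\binom{k+\alpha-1}{k}p^\alpha q^k$, $k=0,1,2,\dots$. For $\alpha,\beta>0$, $G_{\alpha,\beta}$ has density $\frac{\beta^\alpha t^{\alpha-1}}{\Gamma(\alpha)}e^{-\beta t}$ for $t\ge0$ and $0$ for $t<0$. $X_1\le_{st}X_2$ means $P(X_1\ge t)\le P(X_2\ge t)$ for all $t\in\mathbb{R}$. For $\vec{x}\in\mathbb{R}^n$, $\vec{x}_\uparrow=(x_{(1)},\dots,x_{(n)})$ and $\vec{x}_\downarrow=(x_{[1]},\dots,x_{[n]})$ are the vectors of components of $\vec x$ in increasing, resp. decreasing, order; $\log\vec{x}=(\log x_1,\dots,\log x_n)$. $\vec{x}\prec^w\vec{y}$ means $\sum_{i=1}^k x_{(i)}\ge\sum_{i=1}^k y_{(i)}$ for $k=1,\dots,n$. $\vec{x}\prec_w\vec{y}$ means $\sum_{i=1}^k x_{[i]}\le\sum_{i=1}^k y_{[i]}$ for $k=1,\dots,n$. $(\vec{x_1},\vec{y_1})=^a(\vec{x_2},\vec{y_2})$ means that there is one permutation $\pi$ with $\vec{x_1}=\pi(\vec{x_2})$ and $\vec{y_1}=\pi(\vec{y_2})$. *)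

theory Defs
  imports "HOL-Probability.Probability" "HOL-Combinatorics.Permutations"
begin

text \<open>
  Vectors in \<open>\<real>\<^sup>n\<close> are lists of length \<open>n\<close>, indexed from 0. Thus \<open>sort x\<close> has the components
  in increasing order, \<open>rev (sort x)\<close> has them in decreasing order, and \<open>map ln x\<close> is the
  componentwise logarithm.
\<close>

definition weak_supermaj :: "real list \<Rightarrow> real list \<Rightarrow> bool"  (infix \<open>\<prec>\<^sup>w\<close> 50) where
  "x \<prec>\<^sup>w y \<longleftrightarrow> length x = length y \<and>
     (\<forall>k\<in>{1..length x}. (\<Sum>i<k. sort x ! i) \<ge> (\<Sum>i<k. sort y ! i))"

definition weak_submaj :: "real list \<Rightarrow> real list \<Rightarrow> bool"  (infix \<open>\<prec>\<^sub>w\<close> 50) where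
  "x \<prec>\<^sub>w y \<longleftrightarrow> length x = length y \<and>
     (\<forall>k\<in>{1..length x}. (\<Sum>i<k. rev (sort x) ! i) \<le> (\<Sum>i<k. rev (sort y) ! i))"

text \<open>All four lists are required to have the same length.\<close>

definition same_arrangement ::
    "real list \<times> real list \<Rightarrow> real list \<times> real list \<Rightarrow> bool"  (infix \<open>=\<^sup>a\<close> 50) where
  "u =\<^sup>a v \<longleftrightarrow> length (fst v) = length (snd v) \<and>
     (\<exists>\<pi>. \<pi> permutes {..<length (fst v)} \<and>
          fst u = permute_list \<pi> (fst v) \<and> snd u = permute_list \<pi> (snd v))"

definition neg_binomial_mass :: "real \<Rightarrow> real \<Rightarrow> nat \<Rightarrow> real" where
  "neg_binomial_mass \<alpha> p k = ((real k + \<alpha> - 1) gchoose k) * p powr \<alpha> * (1 - p) ^ k"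

text \<open>
  Since \<open>0 powr a = 0\<close> for all \<open>a\<close>, this density is 0 at \<open>t = 0\<close>. The value there is immaterial,
  as \<open>{0}\<close> is a Lebesgue null set.
\<close>

definition gamma_density :: "real \<Rightarrow> real \<Rightarrow> real \<Rightarrow> real" where
  "gamma_density \<alpha> \<beta> t =
     (if t < 0 then 0 else \<beta> powr \<alpha> * t powr (\<alpha> - 1) / Gamma \<alpha> * exp (- \<beta> * t))"

definition indep_neg_binomials ::
    "'a measure \<Rightarrow> nat \<Rightarrow> (nat \<Rightarrow> 'a \<Rightarrow> nat) \<Rightarrow> real list \<Rightarrow> real list \<Rightarrow> bool" where
  "indep_neg_binomials M n X \<alpha> p \<longleftrightarrow> prob_space M \<and>
     prob_space.indep_vars M (\<lambda>_. count_space UNIV) X {..<n} \<and>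
     (\<forall>i<n. distributed M (count_space UNIV) (X i)
              (\<lambda>k. ennreal (neg_binomial_mass (\<alpha> ! i) (p ! i) k)))"

definition indep_gammas ::
    "'a measure \<Rightarrow> nat \<Rightarrow> (nat \<Rightarrow> 'a \<Rightarrow> real) \<Rightarrow> real list \<Rightarrow> real list \<Rightarrow> bool" where
  "indep_gammas M n X \<alpha> \<beta> \<longleftrightarrow> prob_space M \<and>
     prob_space.indep_vars M (\<lambda>_. borel) X {..<n} \<and>
     (\<forall>i<n. distributed M lborel (X i)
              (\<lambda>t. ennreal (gamma_density (\<alpha> ! i) (\<beta> ! i) t)))"

text \<open>The two random variables may live on different probability spaces.\<close>

definition st_le :: "'a measure \<Rightarrow> ('a \<Rightarrow> real) \<Rightarrow> 'b measure \<Rightarrow> ('b \<Rightarrow> real) \<Rightarrow> bool" where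
  "st_le M1 X1 M2 X2 \<longleftrightarrow>
     (\<forall>t. \<P>(\<omega> in M1. X1 \<omega> \<ge> t) \<le> \<P>(\<omega> in M2. X2 \<omega> \<ge> t))"

end

theory Submission
  imports Defs
begin

text \<open>
  The generating function of \<open>N\<^bsub>\<alpha>,p\<^esub>\<close> is \<open>(p / (1 - q z)) powr \<alpha>\<close>, whose logarithm is the sum of
  \<open>\<alpha> q\<^sup>k (z\<^sup>k - 1) / k\<close> over \<open>k \<ge> 1\<close>. So the sum of the \<open>N\<^bsub>\<alpha> i,p i\<^esub>\<close> is compound Poisson, with
  mass \<open>(\<Sum>i. \<alpha> i * (1 - p i) ^ k / k)\<close> of its Levy measure at \<open>k\<close>, and a compound Poisson law
  increases stochastically with the tails of its Levy measure. Each tail is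
  \<open>(\<Sum>i. \<alpha> i * h (ln (p i)))\<close> with \<open>h\<close> nonnegative, decreasing and convex on the negative axis:
  its derivative there is \<open>x \<mapsto> - ((1 - exp x) ^ k)\<close>. Such sums are monotone for the two weak
  majorization orders, by summation by parts and the tangent line inequality, when the larger pair
  is oppositely arranged.

  The gamma case is the limit: \<open>N\<^bsub>\<alpha>,\<beta>/m\<^esub> / m\<close> converges to \<open>G\<^bsub>\<alpha>,\<beta>\<^esub>\<close> in distribution as \<open>m\<close>
  tends to infinity, and dividing all \<open>\<beta> i\<close> by \<open>m\<close> preserves the hypothesis on their logarithms.
\<close>

unbundle no vec_syntax
unbundle fps_syntax

section \<open>Compound Poisson laws as power series\<close>

lemma fps_ones_mult_nth: "(Abs_fps (\<lambda>_. 1) * f) $ k = (\<Sum>i\<le>k. f $ i)" for f :: "real fps"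
proof -
  have "(Abs_fps (\<lambda>_. 1) * f) $ k = (f * Abs_fps (\<lambda>_. 1)) $ k" by (simp add: mult.commute)
  then show ?thesis by (simp add: fps_mult_nth atLeast0AtMost)
qed

lemma fps_mult_nth_mono:
  fixes f g h :: "real fps"
  assumes "\<And>k. 0 \<le> h $ k" "\<And>k. f $ k \<le> g $ k"
  shows "(f * h) $ k \<le> (g * h) $ k"
  by (simp add: fps_mult_nth sum_mono mult_right_mono assms)

lemma fps_power_nth_nonneg:
  fixes f :: "real fps"
  assumes "\<And>k. 0 \<le> f $ k"
  shows "0 \<le> (f ^ n) $ k"
  by (induction n arbitrary: k) (auto simp: fps_mult_nth intro!: sum_nonneg mult_nonneg_nonneg assms)

text \<open>With \<open>u\<close> the series of ones, coefficients of \<open>u * f\<close> are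
  partial sums, so convolution powers preserve the order of distribution functions. One factor is
  exchanged at a time: the hypothesis is multiplied by the nonnegative \<open>f ^ n\<close>, the
  induction hypothesis by the nonnegative \<open>g\<close>.\<close>

lemma fps_mult_power_nth_mono:
  fixes f g u :: "real fps"
  assumes f: "\<And>k. 0 \<le> f $ k" and g: "\<And>k. 0 \<le> g $ k" and le: "\<And>k. (u * f) $ k \<le> (u * g) $ k"
  shows "(u * f ^ n) $ k \<le> (u * g ^ n) $ k"
proof (induction n arbitrary: k)
  case (Suc n)
  have "(u * f ^ Suc n) $ k = ((u * f) * f ^ n) $ k" by (simp add: mult_ac)
  also have "\<dots> \<le> ((u * g) * f ^ n) $ k"
    by (intro fps_mult_nth_mono fps_power_nth_nonneg f le)
  also have "\<dots> = ((u * f ^ n) * g) $ k" by (simp add: mult_ac)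
  also have "\<dots> \<le> ((u * g ^ n) * g) $ k"
    by (intro fps_mult_nth_mono g Suc.IH)
  also have "\<dots> = (u * g ^ Suc n) $ k" by (simp add: mult_ac)
  finally show ?case .
qed simp

text \<open>This is exp (G + c) = exp c * exp G, coefficient by coefficient. Formal composition
  requires a vanishing constant term, so the exponential of the shifted series is written as a
  convergent real series. It is the Cauchy product of the series of \<open>c\<close> with a sequence
  that is finite because \<open>G ^ i\<close> starts at degree \<open>i\<close>.\<close>

lemma fps_exp_shift_sums:
  fixes G u :: "real fps"
  assumes G: "G $ 0 = 0"
  shows "(\<lambda>n. (u * (G + fps_const c) ^ n) $ k / fact n) sums (exp c * (u * (fps_exp 1 oo G)) $ k)"
proof -
  define a where "a i = (u * G ^ i) $ k / fact i" for i
  define b where "b j = c ^ j / fact j" for j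
  have van: "(G ^ i) $ j = 0" if "j < i" for i j
    using startsby_zero_power_prefix[OF G] that by blast
  have a0: "a i = 0" if "i > k" for i
    using that by (auto simp: a_def fps_mult_nth van)
  \<comment> \<open>Composition yields an inner sum up to \<open>k - j\<close>. By
    \<open>van\<close> it may run up to \<open>k\<close>, which makes the two sums independent and
    lets them be swapped.\<close>
  have "(u * (fps_exp 1 oo G)) $ k = (\<Sum>j=0..k. u $ j * (\<Sum>i=0..k. (G ^ i) $ (k - j) / fact i))"
    unfolding fps_mult_nth fps_compose_nth
    by (intro sum.cong refl arg_cong2[of _ _ _ _ times] sum.mono_neutral_cong_left) (auto simp: van)
  also have "\<dots> = (\<Sum>i=0..k. a i)"
    unfolding a_def fps_mult_nth sum_distrib_left sum_divide_distrib
    by (subst sum.swap) simp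
  finally have sum_a: "(\<Sum>i. a i) = (u * (fps_exp 1 oo G)) $ k"
    using a0 suminf_finite[of "{0..k}" a] by auto
  have b: "b sums exp c"
    using exp_converges[of c] by (simp add: b_def[abs_def] divide_inverse mult.commute)
  have "(\<lambda>n. \<Sum>i\<le>n. a i * b (n - i)) sums ((\<Sum>i. a i) * (\<Sum>i. b i))"
  proof (rule Cauchy_product_sums)
    show "summable (\<lambda>k. norm (a k))"
      by (rule summable_finite[of "{0..k}"]) (use a0 in auto)
    show "summable (\<lambda>k. norm (b k))"
      using summable_norm_exp[of c] by (simp add: b_def divide_inverse mult.commute)
  qed
  also have "(\<lambda>n. \<Sum>i\<le>n. a i * b (n - i)) = (\<lambda>n. (u * (G + fps_const c) ^ n) $ k / fact n)"
  proof
    fix n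
    have *: "(u * (of_nat (n choose i) * G ^ i * fps_const (c ^ (n - i)))) $ k
        = of_nat (n choose i) * c ^ (n - i) * (u * G ^ i) $ k" for i
    proof -
      have "u * (of_nat (n choose i) * G ^ i * fps_const (c ^ (n - i)))
          = fps_const (of_nat (n choose i) * c ^ (n - i)) * (u * G ^ i)"
        by (simp add: fps_of_nat[symmetric] fps_const_mult[symmetric] mult_ac del: fps_const_mult)
      then show ?thesis by (simp only: fps_mult_left_const_nth)
    qed
    have "(u * (G + fps_const c) ^ n) $ k / fact n
        = (\<Sum>i\<le>n. of_nat (n choose i) * c ^ (n - i) * (u * G ^ i) $ k / fact n)"
      by (simp add: binomial_ring sum_distrib_left fps_sum_nth * sum_divide_distrib)
    also have "\<dots> = (\<Sum>i\<le>n. a i * b (n - i))"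
      by (intro sum.cong refl) (simp add: a_def b_def binomial_fact field_simps)
    finally show "(\<Sum>i\<le>n. a i * b (n - i)) = (u * (G + fps_const c) ^ n) $ k / fact n" ..
  qed
  finally show ?thesis
    using sum_a b by (simp add: sums_iff mult.commute)
qed

text \<open>
  Here \<open>G1\<close> and \<open>G2\<close> generate Levy measures of total mass \<open>l1\<close> and \<open>l2\<close>. In the proof the missing
  mass \<open>l2 - l1\<close> is added to the first one as an atom at \<open>0\<close>, which does not change the law.
\<close>

lemma compound_poisson_cdf_mono:
  fixes G1 G2 :: "real fps"
  assumes zero: "G1 $ 0 = 0" "G2 $ 0 = 0"
    and nonneg: "\<And>k. 0 \<le> G1 $ k" "\<And>k. 0 \<le> G2 $ k"
    and tail: "\<And>k. l1 - (\<Sum>i\<le>k. G1 $ i) \<le> l2 - (\<Sum>i\<le>k. G2 $ i)"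
  shows "exp (- l2) * (\<Sum>i\<le>k. (fps_exp 1 oo G2) $ i) \<le> exp (- l1) * (\<Sum>i\<le>k. (fps_exp 1 oo G1) $ i)"
proof -
  define u where "u = Abs_fps (\<lambda>_. 1 :: real)"
  define c where "c = l2 - l1"
  \<comment> \<open>At index 0 both tails are the total masses, because the constant terms
    vanish.\<close>
  have c: "c \<ge> 0" using tail[of 0] zero by (simp add: c_def)
  have uc: "(u * fps_const c) $ k = c" for k
    by (simp add: u_def)
  have "(u * G2 ^ n) $ k \<le> (u * (G1 + fps_const c) ^ n) $ k" for n
  proof (rule fps_mult_power_nth_mono)
    show "(u * G2) $ j \<le> (u * (G1 + fps_const c)) $ j" for j
      using tail[of j] unfolding ring_distribs fps_add_nth uc
      unfolding u_def fps_ones_mult_nth by (simp add: c_def)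
  qed (use nonneg c in auto)
  then have "(u * (G2 + fps_const 0) ^ n) $ k / fact n \<le> (u * (G1 + fps_const c) ^ n) $ k / fact n" for n
    by (simp add: divide_right_mono)
  from sums_le[OF this fps_exp_shift_sums[OF zero(2)] fps_exp_shift_sums[OF zero(1)]]
  have "(u * (fps_exp 1 oo G2)) $ k \<le> exp c * (u * (fps_exp 1 oo G1)) $ k" by simp
  then have "exp (- l2) * (u * (fps_exp 1 oo G2)) $ k \<le> exp (- l2) * (exp c * (u * (fps_exp 1 oo G1)) $ k)"
    by simp
  also have "\<dots> = exp (- l1) * (u * (fps_exp 1 oo G1)) $ k"
    by (simp add: mult.assoc[symmetric] exp_add[symmetric] c_def)
  finally show ?thesis by (simp add: u_def fps_ones_mult_nth)
qed

section \<open>The negative binomial generating function as an exponential\<close>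

lemma fps_linear_ode_unique:
  fixes f g d :: "real fps"
  assumes "fps_deriv f = d * f" "fps_deriv g = d * g" "f $ 0 = g $ 0"
  shows "f = g"
proof (rule fps_ext)
  fix n show "f $ n = g $ n"
  proof (induction n rule: less_induct)
    case (less n)
    show ?case
    proof (cases n)
      case (Suc m)
      \<comment> \<open>The coefficient of degree \<open>m\<close> in the differential equation
        expresses \<open>h $ Suc m\<close> through lower coefficients.\<close>
      have "real (Suc m) * h $ Suc m = (\<Sum>i=0..m. d $ i * h $ (m - i))" if "fps_deriv h = d * h" for h
        using arg_cong[OF that, of "\<lambda>f. f $ m"] by (simp add: fps_mult_nth)
      moreover have "(\<Sum>i=0..m. d $ i * f $ (m - i)) = (\<Sum>i=0..m. d $ i * g $ (m - i))"
        using less Suc by (intro sum.cong) auto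
      ultimately have "real (Suc m) * f $ Suc m = real (Suc m) * g $ Suc m"
        using assms by metis
      then show ?thesis using Suc by simp
    qed (use assms in simp)
  qed
qed

lemma fps_deriv_prod_log:
  fixes f d :: "'i \<Rightarrow> real fps"
  assumes "finite I" "\<And>i. i \<in> I \<Longrightarrow> fps_deriv (f i) = d i * f i"
  shows "fps_deriv (\<Prod>i\<in>I. f i) = (\<Sum>i\<in>I. d i) * (\<Prod>i\<in>I. f i)"
  using assms by (induction rule: finite_induct) (auto simp: algebra_simps)

definition neg_binomial_fps :: "real \<Rightarrow> real \<Rightarrow> real fps" where
  "neg_binomial_fps \<alpha> p = Abs_fps (neg_binomial_mass \<alpha> p)"

lemma neg_binomial_mass_Suc:
  "real (Suc k) * neg_binomial_mass \<alpha> p (Suc k) = (1 - p) * (real k + \<alpha>) * neg_binomial_mass \<alpha> p k"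
proof -
  have "real (Suc k) * neg_binomial_mass \<alpha> p (Suc k)
      = (real (Suc k) * (real k + \<alpha> gchoose Suc k)) * p powr \<alpha> * (1 - p) ^ Suc k"
    by (simp add: neg_binomial_mass_def)
  also have "real (Suc k) * (real k + \<alpha> gchoose Suc k) = (real k + \<alpha>) * (real k + \<alpha> - 1 gchoose k)"
    by (rule gbinomial_absorption)
  finally show ?thesis
    by (simp add: neg_binomial_mass_def mult_ac)
qed

text \<open>The logarithmic derivative of (p / (1 - q X)) powr \<alpha> is \<alpha> q / (1 - q X), a
  geometric series. Multiplying by \<open>L\<close>, which is 1 - q X, turns the claim into the
  recursion of \<open>neg_binomial_mass_Suc\<close>. Then \<open>L\<close> cancels, since it is not
  0 and formal power series have no zero divisors.\<close>

lemma fps_deriv_neg_binomial: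
  "fps_deriv (neg_binomial_fps \<alpha> p) = Abs_fps (\<lambda>k. \<alpha> * (1 - p) ^ Suc k) * neg_binomial_fps \<alpha> p"
proof -
  define q where "q = 1 - p"
  define A where "A = neg_binomial_fps \<alpha> p"
  define D where "D = Abs_fps (\<lambda>k. \<alpha> * q ^ Suc k)"
  define L where "L = 1 - fps_const q * fps_X"
  have 1: "L * fps_deriv A = fps_const (\<alpha> * q) * A"
  proof (rule fps_ext)
    fix k
    show "(L * fps_deriv A) $ k = (fps_const (\<alpha> * q) * A) $ k"
    proof (cases k)
      case 0
      then show ?thesis using neg_binomial_mass_Suc[of 0 \<alpha> p]
        by (simp add: L_def A_def neg_binomial_fps_def q_def ring_distribs mult.assoc mult.commute)
    next
      case (Suc j)
      then show ?thesis using neg_binomial_mass_Suc[of k \<alpha> p]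
        by (simp add: L_def A_def neg_binomial_fps_def q_def left_diff_distrib mult.assoc del: of_nat_Suc)
           (simp add: algebra_simps)
    qed
  qed
  have 2: "L * D = fps_const (\<alpha> * q)"
  proof (rule fps_ext)
    fix k show "(L * D) $ k = fps_const (\<alpha> * q) $ k"
      by (cases k) (simp_all add: L_def D_def left_diff_distrib mult.assoc)
  qed
  have "L * (fps_deriv A - D * A) = 0"
    using 1 2 by (simp add: right_diff_distrib mult.assoc[symmetric])
  moreover have "L \<noteq> 0"
    by (rule fps_nonzeroI[of _ 0]) (simp add: L_def)
  ultimately show ?thesis by (simp add: A_def D_def q_def)
qed

text \<open>The coefficient at 0 is 0 because \<open>x / 0 = 0\<close>, so there is no atom at the
  origin. For parameters in (0, 1) the coefficients sum to
  \<open>\<Sum>i<n. \<alpha> ! i * - ln (p ! i)\<close> by the logarithm series.\<close>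

definition levy_fps :: "nat \<Rightarrow> real list \<Rightarrow> real list \<Rightarrow> real fps" where
  "levy_fps n \<alpha> p = Abs_fps (\<lambda>k. \<Sum>i<n. \<alpha> ! i * (1 - p ! i) ^ k / real k)"

text \<open>Both sides solve the linear differential equation whose coefficient is the sum of the
  geometric series \<open>?D\<close>, and both have the product of the
  \<open>p ! i powr \<alpha> ! i\<close> as constant term.\<close>

lemma prod_neg_binomial_fps:
  assumes "\<And>i. i < n \<Longrightarrow> 0 < p ! i"
  shows "(\<Prod>i<n. neg_binomial_fps (\<alpha> ! i) (p ! i))
       = fps_const (exp (- (\<Sum>i<n. \<alpha> ! i * - ln (p ! i)))) * (fps_exp 1 oo levy_fps n \<alpha> p)"
proof (rule fps_linear_ode_unique)
  let ?D = "\<Sum>i<n. Abs_fps (\<lambda>k. \<alpha> ! i * (1 - p ! i) ^ Suc k)"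
  show "fps_deriv (\<Prod>i<n. neg_binomial_fps (\<alpha> ! i) (p ! i)) = ?D * (\<Prod>i<n. neg_binomial_fps (\<alpha> ! i) (p ! i))"
    by (intro fps_deriv_prod_log fps_deriv_neg_binomial) auto
  have "fps_deriv (levy_fps n \<alpha> p) = ?D"
    by (rule fps_ext) (simp add: levy_fps_def fps_sum_nth sum_distrib_left del: of_nat_Suc)
  moreover have "levy_fps n \<alpha> p $ 0 = 0" by (simp add: levy_fps_def)
  ultimately show "fps_deriv (fps_const (exp (- (\<Sum>i<n. \<alpha> ! i * - ln (p ! i)))) * (fps_exp 1 oo levy_fps n \<alpha> p))
      = ?D * (fps_const (exp (- (\<Sum>i<n. \<alpha> ! i * - ln (p ! i)))) * (fps_exp 1 oo levy_fps n \<alpha> p))"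
    by (simp add: fps_compose_deriv mult_ac)
  have prod0: "(\<Prod>i\<in>I. f i) $ 0 = (\<Prod>i\<in>I. f i $ 0)" for I :: "nat set" and f :: "nat \<Rightarrow> real fps"
    by (induction I rule: infinite_finite_induct) auto
  show "(\<Prod>i<n. neg_binomial_fps (\<alpha> ! i) (p ! i)) $ 0
      = (fps_const (exp (- (\<Sum>i<n. \<alpha> ! i * - ln (p ! i)))) * (fps_exp 1 oo levy_fps n \<alpha> p)) $ 0"
    using assms
    by (simp add: prod0 neg_binomial_fps_def neg_binomial_mass_def sum_negf exp_sum powr_def less_imp_neq[THEN not_sym])
qed

text \<open>
  For \<open>x = ln p < 0\<close> this is the sum of \<open>(1 - p) ^ j / j\<close> over all \<open>j > k\<close>, because the full series
  sums to \<open>- ln p\<close>. The summand for \<open>j = 0\<close> is \<open>0\<close>, since \<open>1 / 0 = 0\<close>.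
\<close>

definition log_tail :: "nat \<Rightarrow> real \<Rightarrow> real" where
  "log_tail k x = - x - (\<Sum>j\<le>k. (1 - exp x) ^ j / real j)"

lemma prod_neg_binomial_cdf_mono:
  assumes pos: "\<And>i. i < n \<Longrightarrow> 0 < \<alpha>1 ! i \<and> 0 < \<alpha>2 ! i"
    and p: "\<And>i. i < n \<Longrightarrow> 0 < p1 ! i \<and> p1 ! i < 1" "\<And>i. i < n \<Longrightarrow> 0 < p2 ! i \<and> p2 ! i < 1"
    and tail: "\<And>k. (\<Sum>i<n. \<alpha>1 ! i * log_tail k (ln (p1 ! i))) \<le> (\<Sum>i<n. \<alpha>2 ! i * log_tail k (ln (p2 ! i)))"
  shows "(\<Sum>i\<le>k. (\<Prod>i<n. neg_binomial_fps (\<alpha>2 ! i) (p2 ! i)) $ i)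
       \<le> (\<Sum>i\<le>k. (\<Prod>i<n. neg_binomial_fps (\<alpha>1 ! i) (p1 ! i)) $ i)"
proof -
  define l where "l a p = (\<Sum>i<n. a ! i * - ln (p ! i))" for a p :: "real list"
  \<comment> \<open>Total mass minus a partial sum of the Levy measure is the weighted sum of the
    functions \<open>log_tail\<close>, so the hypothesis \<open>tail\<close> compares Levy
    tails.\<close>
  have tl: "l a p - (\<Sum>j\<le>k. levy_fps n a p $ j) = (\<Sum>i<n. a ! i * log_tail k (ln (p ! i)))"
    if "\<And>i. i < n \<Longrightarrow> 0 < p ! i" for k a p
  proof -
    have "(\<Sum>j\<le>k. levy_fps n a p $ j) = (\<Sum>i<n. a ! i * (\<Sum>j\<le>k. (1 - p ! i) ^ j / real j))"
      by (simp add: levy_fps_def sum.swap[of _ "{..<n}"] sum_distrib_left)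
    then show ?thesis
      using that by (simp add: l_def log_tail_def sum_subtractf[symmetric] right_diff_distrib sum_negf[symmetric] del: sum_negf)
  qed
  have nn: "0 \<le> levy_fps n a p $ k" 
    if "\<And>i. i < n \<Longrightarrow> 0 < a ! i" "\<And>i. i < n \<Longrightarrow> p ! i < 1" for a p k
    using that by (auto simp: levy_fps_def less_imp_le intro!: sum_nonneg)
  have "exp (- l \<alpha>2 p2) * (\<Sum>i\<le>k. (fps_exp 1 oo levy_fps n \<alpha>2 p2) $ i)
      \<le> exp (- l \<alpha>1 p1) * (\<Sum>i\<le>k. (fps_exp 1 oo levy_fps n \<alpha>1 p1) $ i)"
  proof (rule compound_poisson_cdf_mono)
    show "l \<alpha>1 p1 - (\<Sum>i\<le>k. levy_fps n \<alpha>1 p1 $ i) \<le> l \<alpha>2 p2 - (\<Sum>i\<le>k. levy_fps n \<alpha>2 p2 $ i)" for k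
      using tail[of k] p by (simp add: tl)
    show "levy_fps n \<alpha>1 p1 $ 0 = 0" "levy_fps n \<alpha>2 p2 $ 0 = 0"
      by (simp_all add: levy_fps_def)
  qed (use pos p in \<open>auto intro!: nn\<close>)
  then show ?thesis
    using p by (simp add: prod_neg_binomial_fps l_def sum_distrib_left)
qed

section \<open>Weak majorization\<close>

text \<open>Summation by parts, done as an induction: the partial sums of \<open>v - u\<close> are
  nonnegative, so replacing the weight \<open>a k\<close> by the smaller \<open>a (Suc k)\<close> in
  front of such a sum can only decrease it.\<close>

lemma sum_mult_antimono_le:
  fixes a u v :: "nat \<Rightarrow> real"
  assumes nonneg: "\<And>i. i < n \<Longrightarrow> 0 \<le> a i"
    and antimono: "\<And>i j. i \<le> j \<Longrightarrow> j < n \<Longrightarrow> a j \<le> a i"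
    and partial: "\<And>k. k \<in> {1..n} \<Longrightarrow> (\<Sum>i<k. u i) \<le> (\<Sum>i<k. v i)"
  shows "(\<Sum>i<n. a i * u i) \<le> (\<Sum>i<n. a i * v i)"
proof -
  define d where "d i = v i - u i" for i
  have D: "0 \<le> (\<Sum>i<Suc k. d i)" if "k < n" for k
    using partial[of "Suc k"] that by (simp add: d_def sum_subtractf del: sum.lessThan_Suc)
  have abel: "a k * (\<Sum>i<Suc k. d i) \<le> (\<Sum>i<Suc k. a i * d i)" if "k < n" for k
    using that
  proof (induction k)
    case (Suc k)
    have "a (Suc k) * (\<Sum>i<Suc k. d i) \<le> a k * (\<Sum>i<Suc k. d i)"
      using Suc.prems by (intro mult_right_mono antimono D) auto
    also have "\<dots> \<le> (\<Sum>i<Suc k. a i * d i)" using Suc by simp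
    finally show ?case by (simp add: algebra_simps)
  qed simp
  have "0 \<le> (\<Sum>i<n. a i * d i)"
  proof (cases n)
    case (Suc m)
    then have "0 \<le> a m * (\<Sum>i<Suc m. d i)" by (intro mult_nonneg_nonneg nonneg D) auto
    also have "\<dots> \<le> (\<Sum>i<Suc m. a i * d i)" using Suc by (intro abel) auto
    finally show ?thesis using Suc by simp
  qed simp
  then show ?thesis by (simp add: d_def right_diff_distrib sum_subtractf)
qed

text \<open>Let \<open>c\<close> be the entry of rank \<open>card J\<close> from the top. After
  subtracting \<open>c\<close> from each term, passing to positive parts and then to all indices
  only increases the left side, and the positive parts that survive belong to the
  \<open>card J\<close> largest entries.\<close>

lemma sum_nth_le_sum_largest:
  fixes xs :: "real list"
  assumes J: "J \<subseteq> {..<length xs}"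
  shows "(\<Sum>j\<in>J. xs ! j) \<le> (\<Sum>i<card J. rev (sort xs) ! i)"
proof (cases "card J")
  case 0
  with J have "J = {}" using finite_subset by fastforce
  then show ?thesis by simp
next
  case (Suc m)
  define d where "d = rev (sort xs)"
  define c where "c = d ! m"
  have m: "m < length xs" using Suc J card_mono[OF _ J] by simp
  have d: "d ! j \<le> d ! i" if "i \<le> j" "j < length xs" for i j
    using that by (auto simp: d_def rev_nth intro!: sorted_nth_mono)
  have dc: "d ! j \<le> c" if "m \<le> j" "j < length xs" for j
    using d[OF that] by (simp add: c_def)
  have cd: "c \<le> d ! j" if "j \<le> m" for j
    using d[OF that m] by (simp add: c_def)
  have len_d: "length d = length xs" by (simp add: d_def)
  \<comment> \<open>A sum over all indices depends only on the multiset of entries, so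
    \<open>xs\<close> may be replaced by its sorted version.\<close>
  have sum_nth: "(\<Sum>i<length ys. f (ys ! i)) = sum_mset (image_mset f (mset ys))"
    for f :: "real \<Rightarrow> real" and ys
    using sum_list_sum_nth[of "map f ys"] by (simp add: sum_mset_sum_list[symmetric] atLeast0LessThan)
  have "(\<Sum>j\<in>J. xs ! j - c) \<le> (\<Sum>j\<in>J. max 0 (xs ! j - c))"
    by (intro sum_mono) simp
  also have "\<dots> \<le> (\<Sum>j<length xs. max 0 (xs ! j - c))"
    using J by (intro sum_mono2) auto
  also have "\<dots> = (\<Sum>j<length d. max 0 (d ! j - c))"
    unfolding sum_nth[of "\<lambda>t. max 0 (t - c)"] by (simp add: d_def)
  also have "\<dots> = (\<Sum>j<Suc m. max 0 (d ! j - c))"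
  proof (rule sum.mono_neutral_right)
    show "\<forall>j\<in>{..<length d} - {..<Suc m}. max 0 (d ! j - c) = 0"
      using dc len_d by (simp add: max_absorb1)
  qed (use m len_d in auto)
  also have "\<dots> = (\<Sum>j<Suc m. d ! j - c)"
    using cd by (intro sum.cong) (simp_all add: max_absorb2 less_Suc_eq_le)
  finally show ?thesis
    using Suc by (simp add: sum_subtractf d_def del: sum.lessThan_Suc)
qed

lemma sort_map_mono_on:
  assumes "mono_on (set xs) f"
  shows "sort (map f xs) = map f (sort xs)"
proof (rule properties_for_sort)
  show "sorted (map f (sort xs))"
    unfolding sorted_map
    by (rule sorted_wrt_mono_rel[of _ "(\<le>)"]) (use assms in \<open>auto dest: mono_onD\<close>)
qed simp

text \<open>Convexity enters as a monotone slope \<open>f'\<close> with the tangent line inequality.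
  The weights are changed first, with the points of \<open>x1\<close> kept in increasing order, and
  the points afterwards, with the weights kept in decreasing order. Hence the right side pairs large
  weights with small points.\<close>

lemma majorization_sum_le:
  fixes f f' :: "real \<Rightarrow> real"
  assumes len: "length a1 = n" "length a2 = n" "length x1 = n" "length x2 = n"
    and maj: "a1 \<prec>\<^sub>w a2" "x1 \<prec>\<^sup>w x2"
    and S: "set x1 \<subseteq> S" "set x2 \<subseteq> S"
    and nonneg: "\<And>x. x \<in> S \<Longrightarrow> 0 \<le> f x" "\<And>a. a \<in> set a2 \<Longrightarrow> 0 \<le> a"
    and slope_nonpos: "\<And>x. x \<in> S \<Longrightarrow> f' x \<le> 0"
    and slope_mono: "mono_on S f'"
    and tangent: "\<And>x y. x \<in> S \<Longrightarrow> y \<in> S \<Longrightarrow> f' x * (y - x) \<le> f y - f x"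
  shows "(\<Sum>i<n. a1 ! i * f (x1 ! i)) \<le> (\<Sum>i<n. rev (sort a2) ! i * f (sort x2 ! i))"
proof -
  define X1 where "X1 = sort x1"
  define X2 where "X2 = sort x2"
  define A where "A = rev (sort a2)"
  have X: "X1 ! i \<in> S" "X2 ! i \<in> S" if "i < n" for i
    using that S len nth_mem[of i X1] nth_mem[of i X2] by (auto simp: X1_def X2_def)
  have X1_mono: "X1 ! i \<le> X1 ! j" if "i \<le> j" "j < n" for i j
    using that len by (simp add: X1_def sorted_nth_mono)
  have A_nonneg: "0 \<le> A ! i" if "i < n" for i
    using that len nonneg(2) nth_mem[of i A] by (simp add: A_def)
  have A_antimono: "A ! j \<le> A ! i" if "i \<le> j" "j < n" for i j
    using that len by (simp add: A_def rev_nth sorted_nth_mono)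
  have f_antimono: "f y \<le> f x" if "x \<in> S" "y \<in> S" "x \<le> y" for x y
  proof -
    have "0 \<le> f' y * (x - y)" using slope_nonpos[of y] that by (simp add: mult_nonpos_nonpos)
    with tangent[of y x] that show ?thesis by simp
  qed
  obtain \<pi> where \<pi>: "\<pi> permutes {..<length x1}" "permute_list \<pi> x1 = X1"
    using mset_eq_permutation[of X1 x1] by (auto simp: X1_def)
  have X1_nth: "X1 ! i = x1 ! \<pi> i" if "i < n" for i
    using that \<pi> len by (auto simp: permute_list_nth)
  have "(\<Sum>i<n. a1 ! i * f (x1 ! i)) = (\<Sum>i<n. a1 ! \<pi> i * f (x1 ! \<pi> i))"
    using \<pi> len sum.permute[of \<pi> "{..<n}" "\<lambda>i. a1 ! i * f (x1 ! i)"] by (simp add: comp_def)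
  also have "\<dots> = (\<Sum>i<n. f (X1 ! i) * a1 ! \<pi> i)"
    by (intro sum.cong) (auto simp: X1_nth)
  \<comment> \<open>Summation by parts with the nonnegative decreasing factors
    \<open>f (X1 ! i)\<close>: any \<open>k\<close> entries of \<open>a1\<close> sum to at most its
    \<open>k\<close> largest, which weak majorization bounds by those of \<open>a2\<close>.\<close>
  also have "\<dots> \<le> (\<Sum>i<n. f (X1 ! i) * A ! i)"
  proof (rule sum_mult_antimono_le)
    fix k assume k: "k \<in> {1..n}"
    have inj: "inj_on \<pi> {..<k}" using \<pi> by (meson inj_on_subset permutes_inj subset_UNIV)
    have sub: "\<pi> ` {..<k} \<subseteq> {..<length a1}"
    proof
      fix j assume "j \<in> \<pi> ` {..<k}"
      then obtain i where "i < k" "j = \<pi> i" by blast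
      with k len permutes_in_image[OF \<pi>(1), of i] show "j \<in> {..<length a1}" by simp
    qed
    have "(\<Sum>i<k. a1 ! \<pi> i) = (\<Sum>j\<in>\<pi> ` {..<k}. a1 ! j)"
      using inj by (simp add: sum.reindex)
    also have "\<dots> \<le> (\<Sum>i<k. rev (sort a1) ! i)"
      using sum_nth_le_sum_largest[OF sub] inj by (simp add: card_image)
    also have "\<dots> \<le> (\<Sum>i<k. A ! i)"
      using maj(1) k len by (simp add: weak_submaj_def A_def)
    finally show "(\<Sum>i<k. a1 ! \<pi> i) \<le> (\<Sum>i<k. A ! i)" .
  qed (auto intro!: nonneg(1) X f_antimono X1_mono)
  also have "\<dots> = (\<Sum>i<n. A ! i * f (X1 ! i))" by (simp add: mult.commute)
  also have "\<dots> \<le> (\<Sum>i<n. A ! i * f (X2 ! i))"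
  proof -
    \<comment> \<open>Summation by parts again: \<open>A ! i\<close> and
      \<open>- f' (X1 ! i)\<close> are both nonnegative and decreasing in \<open>i\<close>, hence so
      is their product. The tangents at the points \<open>X1 ! i\<close> then pass from this linear
      comparison to \<open>f\<close>.\<close>
    have "(\<Sum>i<n. (A ! i * - f' (X1 ! i)) * X2 ! i) \<le> (\<Sum>i<n. (A ! i * - f' (X1 ! i)) * X1 ! i)"
    proof (rule sum_mult_antimono_le)
      show "(\<Sum>i<k. X2 ! i) \<le> (\<Sum>i<k. X1 ! i)" if "k \<in> {1..n}" for k
        using maj(2) len that by (simp add: weak_supermaj_def X1_def X2_def)
      show "A ! j * - f' (X1 ! j) \<le> A ! i * - f' (X1 ! i)" if "i \<le> j" "j < n" for i j
        using that X mono_onD[OF slope_mono X(1) X(1) X1_mono, of i j]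
        by (intro mult_mono A_antimono A_nonneg) (auto simp: slope_nonpos)
      show "0 \<le> A ! i * - f' (X1 ! i)" if "i < n" for i
        using that A_nonneg slope_nonpos[OF X(1)] by (intro mult_nonneg_nonneg) auto
    qed
    then have "0 \<le> (\<Sum>i<n. (A ! i * - f' (X1 ! i)) * X1 ! i - (A ! i * - f' (X1 ! i)) * X2 ! i)"
      by (simp only: sum_subtractf diff_ge_0_iff_ge)
    also have "\<dots> = (\<Sum>i<n. A ! i * (f' (X1 ! i) * (X2 ! i - X1 ! i)))"
      by (intro sum.cong) (simp_all add: algebra_simps)
    also have "\<dots> \<le> (\<Sum>i<n. A ! i * (f (X2 ! i) - f (X1 ! i)))"
      by (intro sum_mono mult_left_mono tangent A_nonneg X) auto
    finally show ?thesis by (simp add: right_diff_distrib sum_subtractf)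
  qed
  finally show ?thesis by (simp add: A_def X2_def)
qed

text \<open>A permutation common to both lists does not change the sum. Reversing the index then
  turns the pair (increasing, decreasing) into (decreasing, increasing), the form in which
  \<open>majorization_sum_le\<close> delivers its bound.\<close>

lemma sum_opposite_arrangement:
  fixes f :: "real \<Rightarrow> real \<Rightarrow> real"
  assumes len: "length a = n" "length b = n"
    and arr: "(a, b) =\<^sup>a (sort a, rev (sort b))"
  shows "(\<Sum>i<n. f (a ! i) (b ! i)) = (\<Sum>i<n. f (rev (sort a) ! i) (sort b ! i))"
proof -
  from arr obtain \<pi> where \<pi>: "\<pi> permutes {..<n}"
    and ab: "a = permute_list \<pi> (sort a)" "b = permute_list \<pi> (rev (sort b))"
    using len by (auto simp: same_arrangement_def)
  have nth: "a ! i = sort a ! \<pi> i" "b ! i = rev (sort b) ! \<pi> i" if "i < n" for i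
    by (subst ab, subst permute_list_nth; use that \<pi> len in simp)+
  have "(\<Sum>i<n. f (a ! i) (b ! i)) = (\<Sum>i<n. f (sort a ! \<pi> i) (rev (sort b) ! \<pi> i))"
    by (intro sum.cong refl arg_cong2[of _ _ _ _ f]) (auto simp: nth)
  also have "\<dots> = (\<Sum>i<n. f (sort a ! i) (rev (sort b) ! i))"
    using \<pi> sum.permute[of \<pi> "{..<n}" "\<lambda>i. f (sort a ! i) (rev (sort b) ! i)"] by (simp add: comp_def)
  also have "\<dots> = (\<Sum>i<n. f (rev (sort a) ! i) (sort b ! i))"
    by (subst sum.nat_diff_reindex[symmetric]) (auto intro!: sum.cong simp: rev_nth len Suc_diff_Suc)
  finally show ?thesis .
qed

section \<open>The tail function: slope, convexity and sign\<close>

lemma log_tail_deriv: "(log_tail k has_real_derivative - ((1 - exp x) ^ k)) (at x)"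
proof (induction k)
  case 0
  show ?case unfolding log_tail_def[abs_def] by (auto intro!: derivative_eq_intros)
next
  case (Suc k)
  have eq: "log_tail (Suc k) = (\<lambda>x. log_tail k x - (1 - exp x) ^ Suc k / real (Suc k))"
    by (auto simp: log_tail_def)
  \<comment> \<open>The subtracted term has derivative - (1 - exp x) ^ k * exp x, so the new
    derivative is - (1 - exp x) ^ k * (1 - exp x), the next power.\<close>
  show ?case unfolding eq
    by (rule derivative_eq_intros Suc.IH refl | simp del: of_nat_Suc power_Suc)+ (simp add: algebra_simps)
qed

lemma log_tail_slope_mono: "mono_on {..0} (\<lambda>x. - ((1 - exp x) ^ k) :: real)"
  by (auto intro!: mono_onI power_mono)

text \<open>By the mean value theorem the difference quotient is the slope at an intermediate point,
  and the slope is monotone on the nonpositive axis.\<close>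

lemma log_tail_tangent:
  assumes "x \<le> 0" "y \<le> 0"
  shows "- ((1 - exp x) ^ k) * (y - x) \<le> log_tail k y - log_tail k x"
proof (cases x y rule: linorder_cases)
  case less
  then obtain z where z: "x < z" "z < y" "log_tail k y - log_tail k x = (y - x) * - ((1 - exp z) ^ k)"
    using MVT2[of x y "log_tail k" "\<lambda>x. - ((1 - exp x) ^ k)"] log_tail_deriv by blast
  then show ?thesis
    using mono_onD[OF log_tail_slope_mono, of x z k] assms
    by (simp add: mult.commute[of "y - x"] mult_right_mono)
next
  case greater
  then obtain z where z: "y < z" "z < x" "log_tail k x - log_tail k y = (x - y) * - ((1 - exp z) ^ k)"
    using MVT2[of y x "log_tail k" "\<lambda>x. - ((1 - exp x) ^ k)"] log_tail_deriv by blast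
  then have "(x - y) * - ((1 - exp z) ^ k) \<le> (x - y) * - ((1 - exp x) ^ k)"
    using mono_onD[OF log_tail_slope_mono, of z x k] assms by (intro mult_left_mono) auto
  with z show ?thesis by (simp add: algebra_simps)
qed simp

lemma log_tail_nonneg: "x \<le> 0 \<Longrightarrow> 0 \<le> log_tail k x"
proof -
  assume "x \<le> 0"
  have "0 ^ j / real j = (0::real)" for j by (cases j) auto
  then have "log_tail k 0 = 0" by (simp only: log_tail_def exp_zero diff_self minus_zero sum.neutral_const)
  \<comment> \<open>The tangent at 0 has slope - (0 ^ k), which is -1 for \<open>k = 0\<close> and 0
    otherwise. In both cases it is nonnegative at \<open>x\<close>.\<close>
  with log_tail_tangent[of 0 x k] \<open>x \<le> 0\<close> show ?thesis
    by (cases k) auto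
qed

lemma log_tail_sum_le:
  assumes len: "length \<alpha>1 = n" "length \<alpha>2 = n" "length p1 = n" "length p2 = n"
    and pos: "\<And>i. i < n \<Longrightarrow> 0 < \<alpha>2 ! i"
    and p: "\<And>i. i < n \<Longrightarrow> 0 < p1 ! i \<and> p1 ! i < 1" "\<And>i. i < n \<Longrightarrow> 0 < p2 ! i \<and> p2 ! i < 1"
    and arr: "(\<alpha>2, p2) =\<^sup>a (sort \<alpha>2, rev (sort p2))"
    and maj: "\<alpha>1 \<prec>\<^sub>w \<alpha>2" "map ln p1 \<prec>\<^sup>w map ln p2"
  shows "(\<Sum>i<n. \<alpha>1 ! i * log_tail k (ln (p1 ! i))) \<le> (\<Sum>i<n. \<alpha>2 ! i * log_tail k (ln (p2 ! i)))"
proof -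
  have "(\<Sum>i<n. \<alpha>1 ! i * log_tail k (map ln p1 ! i))
      \<le> (\<Sum>i<n. rev (sort \<alpha>2) ! i * log_tail k (sort (map ln p2) ! i))"
  proof (rule majorization_sum_le[where S = "{..0}"])
    show "- ((1 - exp x) ^ k) * (y - x) \<le> log_tail k y - log_tail k x" if "x \<in> {..0}" "y \<in> {..0}" for x y
      using log_tail_tangent that by auto
  qed (use len maj p pos in \<open>auto simp: in_set_conv_nth log_tail_nonneg less_imp_le intro!: log_tail_slope_mono\<close>)
  also have "sort (map ln p2) = map ln (sort p2)"
    using p(2) len by (intro sort_map_mono_on mono_onI) (auto simp: in_set_conv_nth)
  also have "(\<Sum>i<n. rev (sort \<alpha>2) ! i * log_tail k (map ln (sort p2) ! i))
      = (\<Sum>i<n. \<alpha>2 ! i * log_tail k (ln (p2 ! i)))"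
    using sum_opposite_arrangement[OF len(2,4) arr, of "\<lambda>a b. a * log_tail k (ln b)"] len by simp
  finally show ?thesis using len by simp
qed

section \<open>Sums of independent negative binomial variables\<close>

text \<open>The rising factorial makes nonnegativity visible for positive \<alpha> and matches the
  ratio of Gamma values in the mixture formula.\<close>

lemma neg_binomial_mass_pochhammer:
  "neg_binomial_mass \<alpha> p k = pochhammer \<alpha> k / fact k * p powr \<alpha> * (1 - p) ^ k"
  by (simp add: neg_binomial_mass_def gbinomial_pochhammer')

lemma neg_binomial_mass_nonneg:
  "0 < \<alpha> \<Longrightarrow> p < 1 \<Longrightarrow> 0 \<le> neg_binomial_mass \<alpha> p k"
  by (auto simp: neg_binomial_mass_pochhammer pochhammer_nonneg less_imp_le)

lemma (in prob_space) prob_indep_sum_eq_prod_fps: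
  fixes X :: "'i \<Rightarrow> 'a \<Rightarrow> nat"
  assumes "finite I" "indep_vars (\<lambda>_. count_space UNIV) X I"
  shows "prob {\<omega> \<in> space M. (\<Sum>i\<in>I. X i \<omega>) = k}
       = (\<Prod>i\<in>I. Abs_fps (\<lambda>k. prob {\<omega> \<in> space M. X i \<omega> = k})) $ k"
  using assms
proof (induction I arbitrary: k rule: finite_induct)
  case empty
  have "{\<omega> \<in> space M. k = 0} = (if k = 0 then space M else {})" by auto
  then show ?case by (simp add: prob_space eq_commute[of 0 k])
next
  case (insert i I)
  define S where "S \<omega> = (\<Sum>j\<in>I. X j \<omega>)" for \<omega>
  have IH: "prob {\<omega> \<in> space M. S \<omega> = k} = (\<Prod>i\<in>I. Abs_fps (\<lambda>k. prob {\<omega> \<in> space M. X i \<omega> = k})) $ k" for k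
    unfolding S_def using insert.IH[of k] insert.prems by (meson indep_vars_subset subset_insertI)
  have rv: "random_variable (count_space UNIV) (X j)" if "j \<in> insert i I" for j
    using insert.prems that unfolding indep_vars_def by blast
  have rvS: "random_variable (count_space UNIV) S"
    unfolding S_def[abs_def] using rv by simp
  \<comment> \<open>Independence of \<open>X i\<close> from the sum over \<open>I\<close> is
    obtained for the real-valued versions and read off at singletons in \<open>prod\<close>.\<close>
  have "indep_vars (\<lambda>_. borel) (\<lambda>j \<omega>. real (X j \<omega>)) (insert i I)"
    by (rule indep_vars_compose2[OF insert.prems]) simp
  from indep_vars_sum[OF insert.hyps this]
  have ind: "indep_var borel (\<lambda>\<omega>. real (X i \<omega>)) borel (\<lambda>\<omega>. \<Sum>j\<in>I. real (X j \<omega>))" .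
  have prod: "prob {\<omega> \<in> space M. X i \<omega> = a \<and> S \<omega> = b}
      = prob {\<omega> \<in> space M. X i \<omega> = a} * prob {\<omega> \<in> space M. S \<omega> = b}" for a b
  proof -
    have eq: "(\<Sum>j\<in>I. real (X j \<omega>)) = real (S \<omega>)" for \<omega> by (simp add: S_def)
    show ?thesis
      using indep_varD[OF ind, of "{real a}" "{real b}"]
      by (simp add: vimage_def Int_def eq conj_commute)
  qed
  have "prob {\<omega> \<in> space M. (\<Sum>j\<in>insert i I. X j \<omega>) = k}
      = prob (\<Union>a\<in>{0..k}. {\<omega> \<in> space M. X i \<omega> = a \<and> S \<omega> = k - a})"
    using insert.hyps by (intro arg_cong[where f = prob]) (auto simp: S_def)
  also have "\<dots> = (\<Sum>a=0..k. prob {\<omega> \<in> space M. X i \<omega> = a \<and> S \<omega> = k - a})"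
  proof (rule finite_measure_finite_Union)
    have "{\<omega> \<in> space M. X i \<omega> = a \<and> S \<omega> = b} \<in> events" for a b
      using rv[of i] rvS by measurable
    then show "(\<lambda>a. {\<omega> \<in> space M. X i \<omega> = a \<and> S \<omega> = k - a}) ` {0..k} \<subseteq> events" by auto
  qed (auto simp: disjoint_family_on_def)
  also have "\<dots> = (\<Prod>i\<in>insert i I. Abs_fps (\<lambda>k. prob {\<omega> \<in> space M. X i \<omega> = k})) $ k"
    using insert.hyps by (simp add: prod IH fps_mult_nth)
  finally show ?case .
qed

lemma indep_neg_binomials_cdf:
  assumes indep: "indep_neg_binomials M n X \<alpha> p"
    and \<alpha>: "\<And>i. i < n \<Longrightarrow> 0 < \<alpha> ! i" and p: "\<And>i. i < n \<Longrightarrow> p ! i < 1"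
  shows "measure M {\<omega> \<in> space M. (\<Sum>i<n. X i \<omega>) \<le> k}
       = (\<Sum>j\<le>k. (\<Prod>i<n. neg_binomial_fps (\<alpha> ! i) (p ! i)) $ j)"
proof -
  interpret prob_space M using indep by (simp add: indep_neg_binomials_def)
  have iv: "indep_vars (\<lambda>_. count_space UNIV) X {..<n}"
    and dist: "\<And>i. i < n \<Longrightarrow> distributed M (count_space UNIV) (X i)
              (\<lambda>k. ennreal (neg_binomial_mass (\<alpha> ! i) (p ! i) k))"
    using indep by (auto simp: indep_neg_binomials_def)
  have mass: "prob {\<omega> \<in> space M. X i \<omega> = k} = neg_binomial_mass (\<alpha> ! i) (p ! i) k" if "i < n" for i k
  proof -
    have "emeasure M (X i -` {k} \<inter> space M)
        = (\<integral>\<^sup>+ x. ennreal (neg_binomial_mass (\<alpha> ! i) (p ! i) x) * indicator {k} x \<partial>count_space UNIV)"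
      by (rule distributed_emeasure[OF dist[OF that]]) simp
    then show ?thesis
      using neg_binomial_mass_nonneg[OF \<alpha>[OF that] p[OF that], of k]
      by (simp add: measure_def vimage_def Int_def conj_commute)
  qed
  have sum_eq: "prob {\<omega> \<in> space M. (\<Sum>i<n. X i \<omega>) = j} = (\<Prod>i<n. neg_binomial_fps (\<alpha> ! i) (p ! i)) $ j" for j
    unfolding prob_indep_sum_eq_prod_fps[OF finite_lessThan iv]
    by (intro arg_cong2[of _ _ _ _ fps_nth] prod.cong) (auto simp: neg_binomial_fps_def mass)
  have "X i \<in> measurable M (count_space UNIV)" if "i < n" for i
    using dist[OF that] by (simp add: distributed_def)
  then have [measurable]: "(\<lambda>\<omega>. real (\<Sum>i<n. X i \<omega>)) \<in> borel_measurable M"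
    by simp
  have "prob {\<omega> \<in> space M. (\<Sum>i<n. X i \<omega>) \<le> k} = prob (\<Union>j\<in>{..k}. {\<omega> \<in> space M. (\<Sum>i<n. X i \<omega>) = j})"
    by (intro arg_cong[where f = prob]) auto
  also have "\<dots> = (\<Sum>j\<le>k. prob {\<omega> \<in> space M. (\<Sum>i<n. X i \<omega>) = j})"
  proof (rule finite_measure_finite_Union)
    have "{\<omega> \<in> space M. real (\<Sum>i<n. X i \<omega>) = real j} \<in> events" for j
      by measurable
    then show "(\<lambda>j. {\<omega> \<in> space M. (\<Sum>i<n. X i \<omega>) = j}) ` {..k} \<subseteq> events"
      by (auto simp only: of_nat_eq_iff)
  qed (auto simp: disjoint_family_on_def)
  finally show ?thesis by (simp add: sum_eq)
qed

lemma neg_binomial_sum_st_le: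
  assumes len: "length \<alpha>1 = n" "length \<alpha>2 = n" "length p1 = n" "length p2 = n"
    and pos: "\<And>i. i < n \<Longrightarrow> 0 < \<alpha>1 ! i \<and> 0 < \<alpha>2 ! i"
    and p: "\<And>i. i < n \<Longrightarrow> 0 < p1 ! i \<and> p1 ! i < 1" "\<And>i. i < n \<Longrightarrow> 0 < p2 ! i \<and> p2 ! i < 1"
    and indep: "indep_neg_binomials M1 n N1 \<alpha>1 p1" "indep_neg_binomials M2 n N2 \<alpha>2 p2"
    and arr: "(\<alpha>2, p2) =\<^sup>a (sort \<alpha>2, rev (sort p2))"
    and maj: "\<alpha>1 \<prec>\<^sub>w \<alpha>2" "map ln p1 \<prec>\<^sup>w map ln p2"
  shows "st_le M1 (\<lambda>\<omega>. real (\<Sum>i<n. N1 i \<omega>)) M2 (\<lambda>\<omega>. real (\<Sum>i<n. N2 i \<omega>))"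
proof -
  interpret M1: prob_space M1 using indep(1) by (simp add: indep_neg_binomials_def)
  interpret M2: prob_space M2 using indep(2) by (simp add: indep_neg_binomials_def)
  have cdf_le: "measure M2 {\<omega> \<in> space M2. (\<Sum>i<n. N2 i \<omega>) \<le> k} \<le> measure M1 {\<omega> \<in> space M1. (\<Sum>i<n. N1 i \<omega>) \<le> k}" for k
    using prod_neg_binomial_cdf_mono[OF pos p log_tail_sum_le[OF len _ p arr maj], of k] pos p
    by (simp add: indep_neg_binomials_cdf[OF indep(1)] indep_neg_binomials_cdf[OF indep(2)])
  \<comment> \<open>For positive \<open>t\<close> the number \<open>nat \<lceil>t\<rceil>\<close> is
    at least 1, so the truncated subtraction is exact. For \<open>t \<le> 0\<close> both
    probabilities are 1, which is treated separately below.\<close>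
  have compl: "measure M {\<omega> \<in> space M. t \<le> real (\<Sum>i<n. X i \<omega>)}
      = 1 - measure M {\<omega> \<in> space M. (\<Sum>i<n. X i \<omega>) \<le> nat \<lceil>t\<rceil> - 1}"
    if "indep_neg_binomials M n X \<alpha> p" "0 < t" for M :: "'m measure" and X \<alpha> p t
  proof -
    interpret prob_space M using that(1) by (simp add: indep_neg_binomials_def)
    have "X i \<in> measurable M (count_space UNIV)" if "i < n" for i
      using \<open>indep_neg_binomials M n X \<alpha> p\<close> that by (simp add: indep_neg_binomials_def distributed_def)
    then have [measurable]: "(\<lambda>\<omega>. real (\<Sum>i<n. X i \<omega>)) \<in> borel_measurable M"
      by simp
    have iff: "(s \<le> nat \<lceil>t\<rceil> - 1) = (real s < t)" for s :: nat
      using \<open>0 < t\<close> by linarith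
    have "{\<omega> \<in> space M. real (\<Sum>i<n. X i \<omega>) < t} \<in> events" by measurable
    from prob_compl[OF this] show ?thesis
      unfolding iff by (simp add: set_diff_eq not_less conj_commute cong: conj_cong)
  qed
  show ?thesis
    unfolding st_le_def
  proof
    fix t
    show "measure M1 {\<omega> \<in> space M1. real (\<Sum>i<n. N1 i \<omega>) \<ge> t} \<le> measure M2 {\<omega> \<in> space M2. real (\<Sum>i<n. N2 i \<omega>) \<ge> t}"
    proof (cases "0 < t")
      case True
      then show ?thesis
        using cdf_le by (simp only: compl[OF indep(1)] compl[OF indep(2)]) simp
    next
      case False
      then have "t \<le> real s" for s :: nat by (meson not_less of_nat_0_le_iff order_trans)
      then show ?thesis by (simp only: simp_thms Collect_mem_eq M1.prob_space M2.prob_space)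
    qed
  qed
qed

section \<open>Gamma variables as limits\<close>

text \<open>The order compares the masses of open half-lines {..<t}, the left limits of the
  distribution functions. One direction squeezes these masses between values at \<open>x\<close> and
  at \<open>t > x\<close> and uses right continuity; the other takes left limits.\<close>

lemma st_le_iff_cdf:
  assumes "prob_space M1" "prob_space M2"
    and meas: "X1 \<in> borel_measurable M1" "X2 \<in> borel_measurable M2"
  shows "st_le M1 X1 M2 X2 \<longleftrightarrow> (\<forall>x. cdf (distr M2 borel X2) x \<le> cdf (distr M1 borel X1) x)"
proof -
  interpret M1: prob_space M1 by fact
  interpret M2: prob_space M2 by fact
  interpret D1: real_distribution "distr M1 borel X1" using meas by (intro M1.real_distribution_distr)
  interpret D2: real_distribution "distr M2 borel X2" using meas by (intro M2.real_distribution_distr)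
  have ge: "measure M {\<omega> \<in> space M. X \<omega> \<ge> t} = 1 - measure (distr M borel X) {..<t}"
    if "prob_space M" "X \<in> borel_measurable M" for M :: "'m measure" and X :: "'m \<Rightarrow> real" and t
  proof -
    interpret prob_space M by fact
    have [measurable]: "X \<in> borel_measurable M" by fact
    have "{\<omega> \<in> space M. X \<omega> \<ge> t} = space M - {\<omega> \<in> space M. X \<omega> < t}" by auto
    moreover have "{\<omega> \<in> space M. X \<omega> < t} \<in> events" by measurable
    ultimately have "prob {\<omega> \<in> space M. X \<omega> \<ge> t} = 1 - prob {\<omega> \<in> space M. X \<omega> < t}"
      by (simp only: prob_compl)
    then show ?thesis
      by (simp add: measure_distr vimage_def Int_def conj_commute)
  qed
  have st: "st_le M1 X1 M2 X2 \<longleftrightarrow> (\<forall>t. measure (distr M2 borel X2) {..<t} \<le> measure (distr M1 borel X1) {..<t})"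
    using assms by (simp add: st_le_def ge)
  show ?thesis
    unfolding st
  proof (intro iffI allI)
    fix x
    assume le: "\<forall>t. measure (distr M2 borel X2) {..<t} \<le> measure (distr M1 borel X1) {..<t}"
    have "\<forall>\<^sub>F t in at_right x. cdf (distr M2 borel X2) x \<le> cdf (distr M1 borel X1) t"
      unfolding eventually_at_right_field
    proof (intro exI[of _ "x + 1"] conjI allI impI)
      fix t assume "x < t"
      then have "cdf (distr M2 borel X2) x \<le> measure (distr M2 borel X2) {..<t}"
        unfolding cdf_def by (intro D2.finite_measure_mono) auto
      also have "\<dots> \<le> measure (distr M1 borel X1) {..<t}" using le by blast
      also have "\<dots> \<le> cdf (distr M1 borel X1) t"
        unfolding cdf_def by (intro D1.finite_measure_mono) auto
      finally show "cdf (distr M2 borel X2) x \<le> cdf (distr M1 borel X1) t" .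
    qed simp
    moreover have "(cdf (distr M1 borel X1) \<longlongrightarrow> cdf (distr M1 borel X1) x) (at_right x)"
      using D1.cdf_is_right_cont by (simp add: continuous_within)
    ultimately show "cdf (distr M2 borel X2) x \<le> cdf (distr M1 borel X1) x"
      by (intro tendsto_lowerbound) auto
  next
    fix t
    assume "\<forall>x. cdf (distr M2 borel X2) x \<le> cdf (distr M1 borel X1) x"
    then show "measure (distr M2 borel X2) {..<t} \<le> measure (distr M1 borel X1) {..<t}"
      by (intro tendsto_le[OF _ D1.cdf_at_left D2.cdf_at_left]) auto
  qed
qed

text \<open>Weak convergence controls distribution functions only at continuity points. If the
  inequality failed at \<open>x\<close>, right continuity of \<open>cdf A\<close> would keep
  \<open>cdf A y < cdf B x\<close> for \<open>y\<close> slightly above \<open>x\<close>. Atoms are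
  countable, so some such \<open>y\<close> is an atom of neither law, and the limit of the
  inequalities at \<open>y\<close> gives a contradiction.\<close>

lemma weak_conv_cdf_le:
  assumes dist: "real_distribution A" "real_distribution B"
    and conv: "weak_conv_m A' A" "weak_conv_m B' B"
    and le: "\<And>n x. cdf (B' n) x \<le> cdf (A' n) x"
  shows "cdf B x \<le> cdf A x"
proof (rule ccontr)
  interpret A: real_distribution A by fact
  interpret B: real_distribution B by fact
  assume "\<not> cdf B x \<le> cdf A x"
  then have "cdf A x < cdf B x" by simp
  moreover have "(cdf A \<longlongrightarrow> cdf A x) (at_right x)"
    using A.cdf_is_right_cont by (simp add: continuous_within)
  ultimately have "\<forall>\<^sub>F y in at_right x. cdf A y < cdf B x" by (rule order_tendstoD(2)[rotated])
  then obtain b where b: "b > x" "\<And>y. x < y \<Longrightarrow> y < b \<Longrightarrow> cdf A y < cdf B x"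
    by (auto simp: eventually_at_right_field)
  obtain y where y: "y \<in> {x<..<b}" "y \<notin> {x. measure A {x} \<noteq> 0} \<union> {x. measure B {x} \<noteq> 0}"
    using open_minus_countable[of "{x. measure A {x} \<noteq> 0} \<union> {x. measure B {x} \<noteq> 0}" "{x<..<b}"]
      A.countable_support B.countable_support b by auto
  have "cdf B y \<le> cdf A y"
  proof (rule LIMSEQ_le)
    show "(\<lambda>n. cdf (B' n) y) \<longlonglongrightarrow> cdf B y" "(\<lambda>n. cdf (A' n) y) \<longlonglongrightarrow> cdf A y"
      using conv y by (simp_all add: weak_conv_m_def weak_conv_def A.isCont_cdf B.isCont_cdf)
  qed (use le in auto)
  moreover have "cdf B x \<le> cdf B y" using y by (intro B.cdf_nondecreasing) auto
  ultimately show False using b(2)[of y] y by simp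
qed

section \<open>Negative binomial laws as Poisson mixtures over gamma laws\<close>

lemma has_bochner_integral_power_exp:
  fixes a c :: real
  assumes "0 < a" "0 < c"
  shows "has_bochner_integral lborel (\<lambda>t. indicator {0..} t * t powr (a - 1) * exp (- (c * t))) (Gamma a / c powr a)"
proof -
  have "has_bochner_integral lborel (\<lambda>t. indicator {0..} t * t powr (a - 1) / exp t) (Gamma a)"
    by (rule has_bochner_integral_nn_integral)
       (use Gamma_conv_nn_integral_real[OF assms(1)] assms in \<open>auto intro: less_imp_le Gamma_real_pos\<close>)
  \<comment> \<open>Scaling by \<open>c\<close> in the Gamma integral, written in the form
    \<open>0 + c * t\<close> of an affine substitution.\<close>
  then have "has_bochner_integral lborel
      (\<lambda>t. indicator {0..} (0 + c * t) * (0 + c * t) powr (a - 1) / exp (0 + c * t)) (Gamma a /\<^sub>R \<bar>c\<bar>)"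
    using assms by (subst (asm) lborel_has_bochner_integral_real_affine_iff[of c _ _ 0]) auto
  then have "has_bochner_integral lborel
      (\<lambda>t. (1 / c powr (a - 1)) * (indicator {0..} (0 + c * t) * (0 + c * t) powr (a - 1) / exp (0 + c * t)))
      ((1 / c powr (a - 1)) * (Gamma a /\<^sub>R \<bar>c\<bar>))"
    by (rule has_bochner_integral_mult_right)
  also have "(\<lambda>t. (1 / c powr (a - 1)) * (indicator {0..} (0 + c * t) * (0 + c * t) powr (a - 1) / exp (0 + c * t)))
      = (\<lambda>t. indicator {0..} t * t powr (a - 1) * exp (- (c * t)))"
    using assms by (auto simp: fun_eq_iff indicator_def powr_mult exp_minus field_simps zero_le_mult_iff)
  also have "(1 / c powr (a - 1)) * (Gamma a /\<^sub>R \<bar>c\<bar>) = Gamma a / c powr a"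
    using assms by (simp add: powr_diff field_simps)
  finally show ?thesis .
qed

lemma gamma_density_eq:
  "gamma_density \<alpha> \<beta> t = \<beta> powr \<alpha> / Gamma \<alpha> * (indicator {0..} t * t powr (\<alpha> - 1) * exp (- (\<beta> * t)))"
  by (simp add: gamma_density_def indicator_def)

lemma gamma_density_nonneg: "0 < \<alpha> \<Longrightarrow> 0 \<le> gamma_density \<alpha> \<beta> t"
  by (auto simp: gamma_density_def intro!: mult_nonneg_nonneg divide_nonneg_nonneg less_imp_le[OF Gamma_real_pos])

lemma gamma_density_measurable [measurable]: "gamma_density \<alpha> \<beta> \<in> borel_measurable borel"
  unfolding gamma_density_eq[abs_def] by measurable

lemma gamma_density_integrable:
  assumes "0 < \<alpha>" "0 < \<beta>"
  shows "integrable lborel (gamma_density \<alpha> \<beta>)"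
  unfolding gamma_density_eq[abs_def]
  using has_bochner_integral_mult_right[OF has_bochner_integral_power_exp[OF assms]]
  by (rule integrable.intros)

text \<open>A Poisson variable whose mean is \<mu> times a gamma variable is negative binomial: the
  integrand is an unnormalized gamma density with parameters \<open>\<alpha> + k\<close> and
  \<open>\<beta> + \<mu>\<close>.\<close>

lemma neg_binomial_mass_poisson_mixture:
  assumes "0 < \<alpha>" "0 < \<beta>" "0 < \<mu>"
  shows "has_bochner_integral lborel
    (\<lambda>t. gamma_density \<alpha> \<beta> t * (exp (- (\<mu> * t)) * (\<mu> * t) ^ k / fact k))
    (neg_binomial_mass \<alpha> (\<beta> / (\<beta> + \<mu>)) k)"
proof -
  define C where "C = \<beta> powr \<alpha> / Gamma \<alpha> * \<mu> ^ k / fact k"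
  have "has_bochner_integral lborel
      (\<lambda>t. C * (indicator {0..} t * t powr (\<alpha> + real k - 1) * exp (- ((\<beta> + \<mu>) * t))))
      (C * (Gamma (\<alpha> + real k) / (\<beta> + \<mu>) powr (\<alpha> + real k)))"
    using assms by (intro has_bochner_integral_mult_right has_bochner_integral_power_exp) auto
  also have "(\<lambda>t. C * (indicator {0..} t * t powr (\<alpha> + real k - 1) * exp (- ((\<beta> + \<mu>) * t))))
      = (\<lambda>t. gamma_density \<alpha> \<beta> t * (exp (- (\<mu> * t)) * (\<mu> * t) ^ k / fact k))"
  proof
    fix t
    show "C * (indicator {0..} t * t powr (\<alpha> + real k - 1) * exp (- ((\<beta> + \<mu>) * t)))
      = gamma_density \<alpha> \<beta> t * (exp (- (\<mu> * t)) * (\<mu> * t) ^ k / fact k)"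
    \<comment> \<open>The power laws are applied for positive \<open>t\<close>. At 0 both sides
      vanish because \<open>0 powr a = 0\<close>, and below 0 because of the indicator.\<close>
    proof (cases "0 < t")
      case True
      have "t powr (\<alpha> + real k - 1) = t powr (\<alpha> - 1) * t ^ k"
        using True by (simp add: powr_add[symmetric] powr_realpow[symmetric] algebra_simps)
      moreover have "exp (- ((\<beta> + \<mu>) * t)) = exp (- (\<beta> * t)) * exp (- (\<mu> * t))"
        by (simp add: exp_add[symmetric] algebra_simps)
      ultimately show ?thesis
        using True by (simp add: gamma_density_eq C_def power_mult_distrib)
    qed (auto simp: gamma_density_eq indicator_def)
  qed
  also have "C * (Gamma (\<alpha> + real k) / (\<beta> + \<mu>) powr (\<alpha> + real k)) = neg_binomial_mass \<alpha> (\<beta> / (\<beta> + \<mu>)) k"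
  proof -
    have "pochhammer \<alpha> k = Gamma (\<alpha> + real k) / Gamma \<alpha>"
      using assms by (intro pochhammer_Gamma) auto
    moreover have "1 - \<beta> / (\<beta> + \<mu>) = \<mu> / (\<beta> + \<mu>)" using assms by (simp add: field_simps)
    moreover have "(\<beta> + \<mu>) powr (\<alpha> + real k) = (\<beta> + \<mu>) powr \<alpha> * (\<beta> + \<mu>) ^ k"
      using assms by (simp add: powr_add powr_realpow)
    ultimately show ?thesis
      using assms by (simp add: neg_binomial_mass_pochhammer C_def powr_divide power_divide mult_ac)
  qed
  finally show ?thesis .
qed

text \<open>This is the binomial series with exponent - \<alpha> at - (1 - p), whose value p powr (-
  \<alpha>) cancels the factor p powr \<alpha>.\<close>

lemma neg_binomial_mass_sums:
  assumes "0 < p" "p < 1"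
  shows "neg_binomial_mass \<alpha> p sums 1"
proof -
  have "(\<lambda>k. p powr \<alpha> * ((- \<alpha> gchoose k) * (- (1 - p)) ^ k)) sums (p powr \<alpha> * (1 + - (1 - p)) powr (- \<alpha>))"
    using assms by (intro sums_mult gen_binomial_real) auto
  also have "(\<lambda>k. p powr \<alpha> * ((- \<alpha> gchoose k) * (- (1 - p)) ^ k)) = neg_binomial_mass \<alpha> p"
  proof
    fix k
    have "(- 1) ^ k * (- (1 - p)) ^ k = (1 - p) ^ k"
      by (simp add: power_mult_distrib[symmetric])
    then show "p powr \<alpha> * ((- \<alpha> gchoose k) * (- (1 - p)) ^ k) = neg_binomial_mass \<alpha> p k"
      by (simp add: neg_binomial_mass_pochhammer gbinomial_pochhammer mult_ac)
  qed
  also have "p powr \<alpha> * (1 + - (1 - p)) powr (- \<alpha>) = 1"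
    using assms by (simp add: powr_minus)
  finally show ?thesis .
qed

text \<open>Summing the mixture formula over \<open>k\<close> under the integral leaves the Poisson
  generating function. Complex \<open>z\<close> in the closed unit disc is allowed so that points of
  the unit circle give characteristic functions. The interchange is justified by the summable
  masses, which bound the integrals of the norms.\<close>

lemma neg_binomial_pgf_sums:
  fixes z :: complex
  assumes "0 < \<alpha>" "0 < \<beta>" "0 < \<mu>" "norm z \<le> 1"
  shows "(\<lambda>k. neg_binomial_mass \<alpha> (\<beta> / (\<beta> + \<mu>)) k *\<^sub>R z ^ k) sums
    (\<integral>t. gamma_density \<alpha> \<beta> t *\<^sub>R exp (of_real (\<mu> * t) * (z - 1)) \<partial>lborel)"
proof -
  define P where "P k t = gamma_density \<alpha> \<beta> t * (exp (- (\<mu> * t)) * (\<mu> * t) ^ k / fact k)" for k t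
  define p where "p = \<beta> / (\<beta> + \<mu>)"
  have p: "0 < p" "p < 1" using assms by (auto simp: p_def)
  have hbi: "has_bochner_integral lborel (P k) (neg_binomial_mass \<alpha> p k)" for k
    unfolding P_def p_def using assms by (intro neg_binomial_mass_poisson_mixture)
  have int_P: "integrable lborel (P k)" "integral\<^sup>L lborel (P k) = neg_binomial_mass \<alpha> p k" for k
    using hbi[of k] by (simp_all add: has_bochner_integral_iff)
  \<comment> \<open>For negative \<open>t\<close> the power of \<open>\<mu> * t\<close> may be
    negative, but the density vanishes there.\<close>
  have P_nonneg: "0 \<le> P k t" for k t
    using assms by (cases "t < 0") (auto simp: P_def gamma_density_nonneg gamma_density_def
        intro!: mult_nonneg_nonneg divide_nonneg_nonneg less_imp_le[OF Gamma_real_pos])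
  have int_f: "integrable lborel (\<lambda>t. P k t *\<^sub>R z ^ k)" for k
    using int_P by (intro integrable_scaleR_left) auto
  have norm_f: "norm (P k t *\<^sub>R z ^ k) \<le> P k t" for k t
    using P_nonneg[of k t] power_le_one[of "norm z" k] assms
    by (simp add: norm_power mult_left_le)
  have P_sums: "(\<lambda>k. P k t *\<^sub>R z ^ k) sums (gamma_density \<alpha> \<beta> t *\<^sub>R exp (of_real (\<mu> * t) * (z - 1)))"
    for t and z :: complex
  proof -
    have "(\<lambda>k. (gamma_density \<alpha> \<beta> t * exp (- (\<mu> * t))) *\<^sub>R ((of_real (\<mu> * t) * z) ^ k /\<^sub>R fact k)) sums
        ((gamma_density \<alpha> \<beta> t * exp (- (\<mu> * t))) *\<^sub>R exp (of_real (\<mu> * t) * z))"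
      by (intro sums_scaleR_right exp_converges)
    also have "(gamma_density \<alpha> \<beta> t * exp (- (\<mu> * t))) *\<^sub>R exp (of_real (\<mu> * t) * z)
        = gamma_density \<alpha> \<beta> t *\<^sub>R exp (of_real (\<mu> * t) * (z - 1))"
      by (simp add: scaleR_conv_of_real exp_of_real[symmetric] exp_add[symmetric] mult.assoc algebra_simps
          del: exp_of_real)
    also have "(\<lambda>k. (gamma_density \<alpha> \<beta> t * exp (- (\<mu> * t))) *\<^sub>R ((of_real (\<mu> * t) * z) ^ k /\<^sub>R fact k))
        = (\<lambda>k. P k t *\<^sub>R z ^ k)"
      by (simp add: P_def scaleR_conv_of_real power_mult_distrib divide_inverse mult_ac)
    finally show ?thesis .
  qed
  have "(\<lambda>k. integral\<^sup>L lborel (\<lambda>t. P k t *\<^sub>R z ^ k)) sums (\<integral>t. (\<Sum>k. P k t *\<^sub>R z ^ k) \<partial>lborel)"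
  proof (rule sums_integral)
    \<comment> \<open>The Poisson series at z = 1 has exactly the terms \<open>P k t\<close>, which
      dominate the norms for the given \<open>z\<close>.\<close>
    have "summable (\<lambda>k. P k t)" for t
      using P_sums[of t 1] by (auto simp: scaleR_conv_of_real sums_iff summable_of_real_iff)
    then have "summable (\<lambda>k. norm (P k t *\<^sub>R z ^ k))" for t
      by (rule summable_comparison_test') (use norm_f in auto)
    then show "AE t in lborel. summable (\<lambda>k. norm (P k t *\<^sub>R z ^ k))" by simp
    show "summable (\<lambda>k. \<integral>t. norm (P k t *\<^sub>R z ^ k) \<partial>lborel)"
    proof (rule summable_comparison_test')
      show "summable (neg_binomial_mass \<alpha> p)"
        using neg_binomial_mass_sums[OF p] by (simp add: sums_iff)
      show "norm (\<integral>t. norm (P k t *\<^sub>R z ^ k) \<partial>lborel) \<le> neg_binomial_mass \<alpha> p k" for k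
        unfolding int_P(2)[symmetric]
        using integral_mono[OF integrable_norm[OF int_f] int_P(1) norm_f, of k] by simp
    qed
  qed (rule int_f)
  moreover have "integral\<^sup>L lborel (\<lambda>t. P k t *\<^sub>R z ^ k) = neg_binomial_mass \<alpha> p k *\<^sub>R z ^ k" for k
    using int_P by (subst integral_scaleR_left) auto
  moreover have "(\<Sum>k. P k t *\<^sub>R z ^ k) = gamma_density \<alpha> \<beta> t *\<^sub>R exp (of_real (\<mu> * t) * (z - 1))" for t
    using P_sums by (rule sums_unique[symmetric])
  ultimately show ?thesis by (simp add: p_def)
qed

section \<open>Convergence of characteristic functions\<close>

lemma scaled_iexp_tendsto:
  fixes m :: "nat \<Rightarrow> real"
  assumes m: "filterlim m at_top sequentially"
  shows "(\<lambda>k. of_real (m k - \<beta>) * (iexp (t / m k) - 1)) \<longlonglongrightarrow> \<i> * of_real t"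
proof -
  \<comment> \<open>With h = 1 / m the expression is (1 - \<beta> h) times the difference quotient
    at 0 of the function sending h to exp (i t h).\<close>
  define h where "h k = complex_of_real (1 / m k)" for k
  have "(\<lambda>k. 1 / m k) \<longlonglongrightarrow> 0"
    using tendsto_inverse_0_at_top[OF m] by (simp add: inverse_eq_divide)
  from tendsto_of_real[OF this, where 'a = complex] have h0: "h \<longlonglongrightarrow> 0"
    by (simp add: h_def[abs_def])
  have nz: "\<forall>\<^sub>F k in sequentially. m k \<noteq> 0"
    using filterlim_at_top_dense[THEN iffD1, OF m, rule_format, of 0] by eventually_elim auto
  have "((\<lambda>h. exp (\<i> * of_real t * h)) has_field_derivative \<i> * of_real t) (at 0)"
    by (auto intro!: derivative_eq_intros)
  then have "((\<lambda>h. (exp (\<i> * of_real t * h) - 1) / h) \<longlongrightarrow> \<i> * of_real t) (at 0)"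
    by (simp add: DERIV_def)
  moreover have "filterlim h (at 0) sequentially"
    unfolding filterlim_at using h0 nz by (auto simp: h_def elim: eventually_mono)
  ultimately have "(\<lambda>k. (exp (\<i> * of_real t * h k) - 1) / h k) \<longlonglongrightarrow> \<i> * of_real t"
    by (rule filterlim_compose)
  then have "(\<lambda>k. (1 - of_real \<beta> * h k) * ((exp (\<i> * of_real t * h k) - 1) / h k))
      \<longlonglongrightarrow> (1 - of_real \<beta> * 0) * (\<i> * of_real t)"
    by (intro tendsto_intros h0)
  moreover have "\<forall>\<^sub>F k in sequentially. (1 - of_real \<beta> * h k) * ((exp (\<i> * of_real t * h k) - 1) / h k)
      = of_real (m k - \<beta>) * (iexp (t / m k) - 1)"
    using nz by eventually_elim (simp add: h_def field_simps)
  ultimately show ?thesis by (simp add: filterlim_cong)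
qed

text \<open>Dominated convergence with the gamma density itself as bound: for
  \<open>s \<ge> 0\<close> the exponent has real part (m - \<beta>) s (cos (t / m) - 1), which is at
  most 0.\<close>

lemma gamma_mixture_tendsto_char:
  fixes m :: "nat \<Rightarrow> real"
  assumes pos: "0 < \<alpha>" "0 < \<beta>" and m: "filterlim m at_top sequentially" and m\<beta>: "\<And>k. \<beta> < m k"
  shows "(\<lambda>k. \<integral>s. gamma_density \<alpha> \<beta> s *\<^sub>R exp (of_real ((m k - \<beta>) * s) * (iexp (t / m k) - 1)) \<partial>lborel)
    \<longlonglongrightarrow> (\<integral>s. gamma_density \<alpha> \<beta> s *\<^sub>R iexp (t * s) \<partial>lborel)"
proof (rule integral_dominated_convergence[where w = "gamma_density \<alpha> \<beta>"])
  show "integrable lborel (gamma_density \<alpha> \<beta>)" using pos by (rule gamma_density_integrable)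
  show "AE s in lborel. (\<lambda>k. gamma_density \<alpha> \<beta> s *\<^sub>R exp (of_real ((m k - \<beta>) * s) * (iexp (t / m k) - 1)))
      \<longlonglongrightarrow> gamma_density \<alpha> \<beta> s *\<^sub>R iexp (t * s)"
  proof (intro AE_I2)
    fix s
    have "(\<lambda>k. gamma_density \<alpha> \<beta> s *\<^sub>R exp (of_real s * (of_real (m k - \<beta>) * (iexp (t / m k) - 1))))
        \<longlonglongrightarrow> gamma_density \<alpha> \<beta> s *\<^sub>R exp (of_real s * (\<i> * of_real t))"
      by (intro tendsto_intros scaled_iexp_tendsto m)
    then show "(\<lambda>k. gamma_density \<alpha> \<beta> s *\<^sub>R exp (of_real ((m k - \<beta>) * s) * (iexp (t / m k) - 1)))
        \<longlonglongrightarrow> gamma_density \<alpha> \<beta> s *\<^sub>R iexp (t * s)"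
      by (simp add: mult_ac)
  qed
  show "AE s in lborel. norm (gamma_density \<alpha> \<beta> s *\<^sub>R exp (of_real ((m k - \<beta>) * s) * (iexp (t / m k) - 1)))
      \<le> gamma_density \<alpha> \<beta> s" for k
  proof (intro AE_I2)
    fix s
    show "norm (gamma_density \<alpha> \<beta> s *\<^sub>R exp (of_real ((m k - \<beta>) * s) * (iexp (t / m k) - 1)))
      \<le> gamma_density \<alpha> \<beta> s"
    proof (cases "s < 0")
      case False
      have "Re (of_real ((m k - \<beta>) * s) * (iexp (t / m k) - 1)) = ((m k - \<beta>) * s) * (cos (t / m k) - 1)"
        by (simp add: Re_exp)
      also have "\<dots> \<le> 0"
        using False m\<beta>[of k] by (intro mult_nonneg_nonpos) auto
      finally show ?thesis
        using gamma_density_nonneg[OF pos(1), of \<beta> s] by (simp add: mult_left_le)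
    qed (simp add: gamma_density_def)
  qed
qed measurable

text \<open>The mixture rate \<mu> = m - \<beta> gives \<beta> / (\<beta> + \<mu>) = \<beta> / m. So
  the mixing density is the same for every scale \<open>m\<close>, and only the exponent varies with
  it.\<close>

lemma char_neg_binomial:
  assumes indep: "indep_neg_binomials M n X \<alpha> p" and i: "i < n"
    and \<alpha>: "0 < \<alpha> ! i" and p: "p ! i = \<beta> / m" and \<beta>: "0 < \<beta>" "\<beta> < m"
  shows "char (distr M borel (\<lambda>\<omega>. real (X i \<omega>) / m)) t
    = (\<integral>s. gamma_density (\<alpha> ! i) \<beta> s *\<^sub>R exp (of_real ((m - \<beta>) * s) * (iexp (t / m) - 1)) \<partial>lborel)"
proof -
  define f where "f = neg_binomial_mass (\<alpha> ! i) (\<beta> / m)"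
  have p01: "0 < \<beta> / m" "\<beta> / m < 1" using \<beta> by auto
  have f_nonneg: "0 \<le> f k" for k
    unfolding f_def using \<alpha> p01 by (intro neg_binomial_mass_nonneg)
  have dist: "distr M (count_space UNIV) (X i) = density (count_space UNIV) (\<lambda>k. ennreal (f k))"
    and [measurable]: "X i \<in> measurable M (count_space UNIV)"
    using indep i by (auto simp: indep_neg_binomials_def distributed_def f_def p)
  have pow: "iexp (t * (real k / m)) = iexp (t / m) ^ k" for k
    by (simp add: exp_of_nat_mult[symmetric] mult_ac)
  have "char (distr M borel (\<lambda>\<omega>. real (X i \<omega>) / m)) t = (\<integral>\<omega>. iexp (t * (real (X i \<omega>) / m)) \<partial>M)"
    unfolding char_def by (subst integral_distr) auto
  also have "\<dots> = (\<integral>k. iexp (t * (real k / m)) \<partial>distr M (count_space UNIV) (X i))"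
    by (subst integral_distr) auto
  also have "\<dots> = (\<integral>k. f k *\<^sub>R iexp (t * (real k / m)) \<partial>count_space UNIV)"
    unfolding dist by (subst integral_density) (auto simp: f_nonneg)
  also have "\<dots> = (\<Sum>k. f k *\<^sub>R iexp (t * (real k / m)))"
  proof (rule integral_count_space_nat)
    show "integrable (count_space UNIV) (\<lambda>k. f k *\<^sub>R iexp (t * (real k / m)))"
      unfolding integrable_count_space_nat_iff
      using neg_binomial_mass_sums[OF p01, of "\<alpha> ! i"] by (simp add: f_nonneg sums_iff flip: f_def)
  qed
  also have "\<dots> = (\<integral>s. gamma_density (\<alpha> ! i) \<beta> s *\<^sub>R exp (of_real ((m - \<beta>) * s) * (iexp (t / m) - 1)) \<partial>lborel)"
    using neg_binomial_pgf_sums[of "\<alpha> ! i" \<beta> "m - \<beta>" "iexp (t / m)"] \<alpha> \<beta>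
    unfolding pow f_def by (simp add: sums_iff)
  finally show ?thesis .
qed

lemma char_gamma:
  assumes indep: "indep_gammas M n X \<alpha> \<beta>" and i: "i < n" and \<alpha>: "0 < \<alpha> ! i"
  shows "char (distr M borel (X i)) t = (\<integral>s. gamma_density (\<alpha> ! i) (\<beta> ! i) s *\<^sub>R iexp (t * s) \<partial>lborel)"
proof -
  have "distr M lborel (X i) = density lborel (\<lambda>s. ennreal (gamma_density (\<alpha> ! i) (\<beta> ! i) s))"
    using indep i by (auto simp: indep_gammas_def distributed_def)
  moreover have "distr M borel (X i) = distr M lborel (X i)"
    by (intro distr_cong) auto
  ultimately show ?thesis
    unfolding char_def by (simp, subst integral_density) (auto simp: gamma_density_nonneg \<alpha>)
qed

section \<open>A product space carrying independent negative binomial variables\<close>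

definition neg_binomial_pmf :: "real \<Rightarrow> real \<Rightarrow> nat pmf" where
  "neg_binomial_pmf \<alpha> p = embed_pmf (neg_binomial_mass \<alpha> p)"

lemma pmf_neg_binomial:
  assumes "0 < \<alpha>" "0 < p" "p < 1"
  shows "pmf (neg_binomial_pmf \<alpha> p) = neg_binomial_mass \<alpha> p"
proof
  fix k
  have "(\<integral>\<^sup>+ k. ennreal (neg_binomial_mass \<alpha> p k) \<partial>count_space UNIV) = 1"
    using suminf_ennreal_eq[OF neg_binomial_mass_nonneg neg_binomial_mass_sums] assms
    by (simp add: nn_integral_count_space_nat)
  then show "pmf (neg_binomial_pmf \<alpha> p) k = neg_binomial_mass \<alpha> p k"
    unfolding neg_binomial_pmf_def using assms by (intro pmf_embed_pmf neg_binomial_mass_nonneg) auto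
qed

text \<open>The gamma statement supplies only gamma variables, so the approximating negative
  binomial ones are built here as coordinates. Coordinates outside \<open>{..<n}\<close> take the
  default value 0.\<close>

definition neg_binomial_space :: "nat \<Rightarrow> real list \<Rightarrow> real list \<Rightarrow> (nat \<Rightarrow> nat) measure" where
  "neg_binomial_space n \<alpha> p = measure_pmf (Pi_pmf {..<n} 0 (\<lambda>i. neg_binomial_pmf (\<alpha> ! i) (p ! i)))"

lemma indep_neg_binomial_space:
  assumes "\<And>i. i < n \<Longrightarrow> 0 < \<alpha> ! i" "\<And>i. i < n \<Longrightarrow> 0 < p ! i \<and> p ! i < 1"
  shows "indep_neg_binomials (neg_binomial_space n \<alpha> p) n (\<lambda>i \<omega>. \<omega> i) \<alpha> p"
proof -
  have "distr (neg_binomial_space n \<alpha> p) (count_space UNIV) (\<lambda>\<omega>. \<omega> i)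
      = density (count_space UNIV) (\<lambda>k. ennreal (neg_binomial_mass (\<alpha> ! i) (p ! i) k))" if "i < n" for i
  proof -
    have "distr (neg_binomial_space n \<alpha> p) (count_space UNIV) (\<lambda>\<omega>. \<omega> i)
        = measure_pmf (map_pmf (\<lambda>\<omega>. \<omega> i) (Pi_pmf {..<n} 0 (\<lambda>i. neg_binomial_pmf (\<alpha> ! i) (p ! i))))"
      by (simp only: neg_binomial_space_def map_pmf_rep_eq)
    also have "\<dots> = measure_pmf (neg_binomial_pmf (\<alpha> ! i) (p ! i))"
      using that by (simp add: Pi_pmf_component)
    finally show ?thesis
      using that assms by (simp add: measure_pmf_eq_density pmf_neg_binomial)
  qed
  then show ?thesis
    by (auto simp: indep_neg_binomials_def distributed_def neg_binomial_space_def
        measure_pmf.prob_space_axioms indep_vars_Pi_pmf)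
qed

text \<open>By independence both characteristic functions are finite products. They converge factor
  by factor, and the Levy continuity theorem turns this into weak convergence.\<close>

lemma scaled_neg_binomials_weak_conv:
  fixes m :: "nat \<Rightarrow> real"
  assumes gam: "indep_gammas M n G \<alpha> \<beta>" and len: "length \<beta> = n"
    and pos: "\<And>i. i < n \<Longrightarrow> 0 < \<alpha> ! i" "\<And>i. i < n \<Longrightarrow> 0 < \<beta> ! i"
    and m: "filterlim m at_top sequentially" and m\<beta>: "\<And>k i. i < n \<Longrightarrow> \<beta> ! i < m k"
    and nb: "\<And>k. indep_neg_binomials (Q k) n X \<alpha> (map (\<lambda>b. b / m k) \<beta>)"
  shows "weak_conv_m (\<lambda>k. distr (Q k) borel (\<lambda>\<omega>. real (\<Sum>i<n. X i \<omega>) / m k)) (distr M borel (\<lambda>\<omega>. \<Sum>i<n. G i \<omega>))"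
proof (rule levy_continuity)
  interpret M: prob_space M using gam by (simp add: indep_gammas_def)
  have Q: "prob_space (Q k)" for k using nb[of k] by (simp add: indep_neg_binomials_def)
  have [measurable]: "X i \<in> measurable (Q k) (count_space UNIV)" if "i < n" for i k
    using nb[of k] that by (simp add: indep_neg_binomials_def distributed_def)
  have G[measurable]: "G i \<in> borel_measurable M" if "i < n" for i
    using gam that by (simp add: indep_gammas_def distributed_def)
  show "real_distribution (distr (Q k) borel (\<lambda>\<omega>. real (\<Sum>i<n. X i \<omega>) / m k))" for k
    by (rule prob_space.real_distribution_distr[OF Q]) simp
  show "real_distribution (distr M borel (\<lambda>\<omega>. \<Sum>i<n. G i \<omega>))"
    by (rule M.real_distribution_distr) simp
  fix t
  have char_Q: "char (distr (Q k) borel (\<lambda>\<omega>. real (\<Sum>i<n. X i \<omega>) / m k)) t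
      = (\<Prod>i<n. \<integral>s. gamma_density (\<alpha> ! i) (\<beta> ! i) s *\<^sub>R
          exp (of_real ((m k - \<beta> ! i) * s) * (iexp (t / m k) - 1)) \<partial>lborel)" for k
  proof -
    interpret prob_space "Q k" by (rule Q)
    have "indep_vars (\<lambda>_. borel) (\<lambda>i \<omega>. real (X i \<omega>) / m k) {..<n}"
      using nb[of k] by (intro indep_vars_compose2[where Y = "\<lambda>_ x. real x / m k"])
        (auto simp: indep_neg_binomials_def)
    then have "char (distr (Q k) borel (\<lambda>\<omega>. \<Sum>i<n. real (X i \<omega>) / m k)) t
        = (\<Prod>i<n. char (distr (Q k) borel (\<lambda>\<omega>. real (X i \<omega>) / m k)) t)"
      by (rule char_distr_sum)
    also have "\<dots> = (\<Prod>i<n. \<integral>s. gamma_density (\<alpha> ! i) (\<beta> ! i) s *\<^sub>R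
          exp (of_real ((m k - \<beta> ! i) * s) * (iexp (t / m k) - 1)) \<partial>lborel)"
      using pos m\<beta> len by (intro prod.cong refl char_neg_binomial[OF nb]) auto
    finally show ?thesis by (simp add: sum_divide_distrib)
  qed
  have char_M: "char (distr M borel (\<lambda>\<omega>. \<Sum>i<n. G i \<omega>)) t
      = (\<Prod>i<n. \<integral>s. gamma_density (\<alpha> ! i) (\<beta> ! i) s *\<^sub>R iexp (t * s) \<partial>lborel)"
    using gam pos by (subst M.char_distr_sum) (auto simp: indep_gammas_def char_gamma[OF gam])
  show "(\<lambda>k. char (distr (Q k) borel (\<lambda>\<omega>. real (\<Sum>i<n. X i \<omega>) / m k)) t)
      \<longlonglongrightarrow> char (distr M borel (\<lambda>\<omega>. \<Sum>i<n. G i \<omega>)) t"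
    unfolding char_Q char_M using pos m\<beta> by (intro tendsto_prod gamma_mixture_tendsto_char m) auto
qed

section \<open>Rescaling the rates and passing to the limit\<close>

lemma sort_map_divide:
  fixes xs :: "real list"
  assumes "0 < c"
  shows "sort (map (\<lambda>x. x / c) xs) = map (\<lambda>x. x / c) (sort xs)"
  using assms by (intro sort_map_mono_on mono_onI) (simp add: divide_right_mono)

lemma same_arrangement_divide:
  assumes arr: "(a, b) =\<^sup>a (sort a, rev (sort b))" and c: "0 < c"
  shows "(a, map (\<lambda>x. x / c) b) =\<^sup>a (sort a, rev (sort (map (\<lambda>x. x / c) b)))"
proof -
  from arr obtain \<pi> where \<pi>: "length a = length b" "\<pi> permutes {..<length a}"
    "a = permute_list \<pi> (sort a)" "b = permute_list \<pi> (rev (sort b))"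
    by (auto simp: same_arrangement_def)
  have "permute_list \<pi> (rev (sort (map (\<lambda>x. x / c) b))) = map (\<lambda>x. x / c) (permute_list \<pi> (rev (sort b)))"
    using \<pi> c by (simp add: sort_map_divide rev_map permute_list_map)
  with \<pi> show ?thesis
    by (auto simp: same_arrangement_def intro!: exI[of _ \<pi>])
qed

text \<open>Division by \<open>c\<close> shifts every logarithm by \<open>- ln c\<close>. Sorting is
  unaffected, and the partial sums of length \<open>k\<close> on both sides change by the same
  \<open>k * ln c\<close>.\<close>

lemma weak_supermaj_ln_divide:
  assumes maj: "map ln x \<prec>\<^sup>w map ln y" and c: "0 < c"
    and pos: "\<And>a. a \<in> set x \<union> set y \<Longrightarrow> 0 < a"
  shows "map ln (map (\<lambda>a. a / c) x) \<prec>\<^sup>w map ln (map (\<lambda>a. a / c) y)"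
proof -
  have eq: "sort (map ln (map (\<lambda>a. a / c) z)) = map (\<lambda>l. l - ln c) (sort (map ln z))"
    if "\<And>a. a \<in> set z \<Longrightarrow> 0 < a" for z
  proof -
    have "map ln (map (\<lambda>a. a / c) z) = map (\<lambda>l. l - ln c) (map ln z)"
      using that c by (auto simp: ln_div)
    then show ?thesis by (simp only: sort_map_mono_on mono_onI diff_right_mono)
  qed
  have len: "length x = length y" using maj by (simp add: weak_supermaj_def)
  show ?thesis
    unfolding weak_supermaj_def
  proof (intro conjI ballI)
    fix k assume k: "k \<in> {1..length (map ln (map (\<lambda>a. a / c) x))}"
    have shift: "(\<Sum>i<k. sort (map ln (map (\<lambda>a. a / c) z)) ! i) = (\<Sum>i<k. sort (map ln z) ! i) - real k * ln c"
      if "\<And>a. a \<in> set z \<Longrightarrow> 0 < a" "length z = length x" for z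
    proof -
      have "(\<Sum>i<k. sort (map ln (map (\<lambda>a. a / c) z)) ! i) = (\<Sum>i<k. sort (map ln z) ! i - ln c)"
      proof (intro sum.cong refl)
        fix i assume "i \<in> {..<k}"
        moreover have "sort (map ln (map (\<lambda>a. a / c) z)) = map (\<lambda>l. l - ln c) (sort (map ln z))"
          using that(1) by (rule eq)
        ultimately show "sort (map ln (map (\<lambda>a. a / c) z)) ! i = sort (map ln z) ! i - ln c"
          using k that(2) by (simp del: map_map)
      qed
      then show ?thesis by (simp add: sum_subtractf)
    qed
    show "(\<Sum>i<k. sort (map ln (map (\<lambda>a. a / c) y)) ! i) \<le> (\<Sum>i<k. sort (map ln (map (\<lambda>a. a / c) x)) ! i)"
      using maj k len pos by (simp add: shift weak_supermaj_def del: map_map)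
  qed (use len in simp)
qed

lemma gamma_sum_st_le:
  assumes len: "length \<alpha>1 = n" "length \<alpha>2 = n" "length \<beta>1 = n" "length \<beta>2 = n"
    and \<alpha>: "\<And>i. i < n \<Longrightarrow> 0 < \<alpha>1 ! i \<and> 0 < \<alpha>2 ! i"
    and \<beta>: "\<And>i. i < n \<Longrightarrow> 0 < \<beta>1 ! i \<and> 0 < \<beta>2 ! i"
    and indep: "indep_gammas M1 n G1 \<alpha>1 \<beta>1" "indep_gammas M2 n G2 \<alpha>2 \<beta>2"
    and arr: "(\<alpha>2, \<beta>2) =\<^sup>a (sort \<alpha>2, rev (sort \<beta>2))"
    and maj: "\<alpha>1 \<prec>\<^sub>w \<alpha>2" "map ln \<beta>1 \<prec>\<^sup>w map ln \<beta>2"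
  shows "st_le M1 (\<lambda>\<omega>. \<Sum>i<n. G1 i \<omega>) M2 (\<lambda>\<omega>. \<Sum>i<n. G2 i \<omega>)"
proof -
  interpret M1: prob_space M1 using indep(1) by (simp add: indep_gammas_def)
  interpret M2: prob_space M2 using indep(2) by (simp add: indep_gammas_def)
  \<comment> \<open>Each \<open>m k\<close> exceeds every rate, so the quotients are valid success
    probabilities, and \<open>m\<close> tends to infinity. One scale serves both families, so
    dividing both sums by it preserves the stochastic order.\<close>
  define m where "m k = sum_list \<beta>1 + sum_list \<beta>2 + 1 + real k" for k
  have nn: "\<forall>x\<in>set \<beta>1. 0 \<le> x" "\<forall>x\<in>set \<beta>2. 0 \<le> x"
    using \<beta> len by (auto simp: in_set_conv_nth less_imp_le)
  then have S: "0 \<le> sum_list \<beta>1" "0 \<le> sum_list \<beta>2" by (auto intro: sum_list_nonneg)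
  have bound: "b < m k" if "b \<in> set \<beta>1 \<union> set \<beta>2" for b k
    using that nn S member_le_sum_list[of b \<beta>1] member_le_sum_list[of b \<beta>2] by (auto simp: m_def)
  have m\<beta>: "\<beta>1 ! i < m k" "\<beta>2 ! i < m k" if "i < n" for i k
    using that len by (auto intro!: bound)
  have m_pos: "0 < m k" for k
    unfolding m_def using S by linarith
  have m: "filterlim m at_top sequentially"
    unfolding m_def by (intro filterlim_tendsto_add_at_top[OF tendsto_const] filterlim_real_sequentially)
  define p1 p2 where "p1 k = map (\<lambda>b. b / m k) \<beta>1" and "p2 k = map (\<lambda>b. b / m k) \<beta>2" for k
  have p: "0 < p1 k ! i \<and> p1 k ! i < 1" "0 < p2 k ! i \<and> p2 k ! i < 1" if "i < n" for i k
    using that len \<beta>[OF that] m\<beta>[OF that] m_pos[of k] by (auto simp: p1_def p2_def)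
  define Q1 Q2 where "Q1 k = neg_binomial_space n \<alpha>1 (p1 k)" and "Q2 k = neg_binomial_space n \<alpha>2 (p2 k)" for k
  have Q1: "indep_neg_binomials (Q1 k) n (\<lambda>i \<omega>. \<omega> i) \<alpha>1 (p1 k)" for k
    unfolding Q1_def using \<alpha> p by (intro indep_neg_binomial_space) auto
  have Q2: "indep_neg_binomials (Q2 k) n (\<lambda>i \<omega>. \<omega> i) \<alpha>2 (p2 k)" for k
    unfolding Q2_def using \<alpha> p by (intro indep_neg_binomial_space) auto
  have st: "st_le (Q1 k) (\<lambda>\<omega>. real (\<Sum>i<n. \<omega> i)) (Q2 k) (\<lambda>\<omega>. real (\<Sum>i<n. \<omega> i))" for k
  proof (rule neg_binomial_sum_st_le[OF _ _ _ _ _ _ _ Q1 Q2])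
    show "(\<alpha>2, p2 k) =\<^sup>a (sort \<alpha>2, rev (sort (p2 k)))"
      unfolding p2_def using arr m_pos by (rule same_arrangement_divide)
    show "map ln (p1 k) \<prec>\<^sup>w map ln (p2 k)"
      unfolding p1_def p2_def using \<beta> len
      by (intro weak_supermaj_ln_divide maj m_pos) (auto simp: in_set_conv_nth)
  qed (use len \<alpha> p maj in \<open>auto simp: p1_def p2_def\<close>)
  have st_scaled: "st_le (Q1 k) (\<lambda>\<omega>. real (\<Sum>i<n. \<omega> i) / m k) (Q2 k) (\<lambda>\<omega>. real (\<Sum>i<n. \<omega> i) / m k)" for k
    using st[of k] m_pos[of k] unfolding st_le_def by (simp add: pos_le_divide_eq)
  have G[measurable]: "G1 i \<in> borel_measurable M1" "G2 i \<in> borel_measurable M2" if "i < n" for i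
    using indep that by (simp_all add: indep_gammas_def distributed_def)
  have "cdf (distr M2 borel (\<lambda>\<omega>. \<Sum>i<n. G2 i \<omega>)) x \<le> cdf (distr M1 borel (\<lambda>\<omega>. \<Sum>i<n. G1 i \<omega>)) x" for x
  proof (rule weak_conv_cdf_le)
    show "real_distribution (distr M1 borel (\<lambda>\<omega>. \<Sum>i<n. G1 i \<omega>))"
      by (rule M1.real_distribution_distr) simp
    show "real_distribution (distr M2 borel (\<lambda>\<omega>. \<Sum>i<n. G2 i \<omega>))"
      by (rule M2.real_distribution_distr) simp
    show "weak_conv_m (\<lambda>k. distr (Q1 k) borel (\<lambda>\<omega>. real (\<Sum>i<n. \<omega> i) / m k)) (distr M1 borel (\<lambda>\<omega>. \<Sum>i<n. G1 i \<omega>))"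
      using \<alpha> \<beta> m\<beta> len Q1 by (intro scaled_neg_binomials_weak_conv[OF indep(1)] m) (auto simp: p1_def)
    show "weak_conv_m (\<lambda>k. distr (Q2 k) borel (\<lambda>\<omega>. real (\<Sum>i<n. \<omega> i) / m k)) (distr M2 borel (\<lambda>\<omega>. \<Sum>i<n. G2 i \<omega>))"
      using \<alpha> \<beta> m\<beta> len Q2 by (intro scaled_neg_binomials_weak_conv[OF indep(2)] m) (auto simp: p2_def)
    show "cdf (distr (Q2 k) borel (\<lambda>\<omega>. real (\<Sum>i<n. \<omega> i) / m k)) x
        \<le> cdf (distr (Q1 k) borel (\<lambda>\<omega>. real (\<Sum>i<n. \<omega> i) / m k)) x" for k x
    proof -
      have "prob_space (Q1 k)" "prob_space (Q2 k)"
        using Q1[of k] Q2[of k] by (simp_all add: indep_neg_binomials_def)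
      moreover have "(\<lambda>\<omega>. real (\<Sum>i<n. \<omega> i) / m k) \<in> borel_measurable (Q1 k)"
        "(\<lambda>\<omega>. real (\<Sum>i<n. \<omega> i) / m k) \<in> borel_measurable (Q2 k)"
        by (simp_all add: Q1_def Q2_def neg_binomial_space_def)
      ultimately show ?thesis using st_scaled[of k] by (simp add: st_le_iff_cdf)
    qed
  qed
  then show ?thesis
    by (subst st_le_iff_cdf) (auto simp: M1.prob_space_axioms M2.prob_space_axioms)
qed

theorem corollary5p11:
  fixes n :: nat
    and \<alpha>1 \<alpha>2 p1 p2 \<beta>1 \<beta>2 :: "real list"
    and M1 :: "'a measure" and N1 :: "nat \<Rightarrow> 'a \<Rightarrow> nat"
    and M2 :: "'b measure" and N2 :: "nat \<Rightarrow> 'b \<Rightarrow> nat"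
    and M3 :: "'c measure" and G1 :: "nat \<Rightarrow> 'c \<Rightarrow> real"
    and M4 :: "'d measure" and G2 :: "nat \<Rightarrow> 'd \<Rightarrow> real"
  assumes "n \<ge> 1"
    and "length \<alpha>1 = n" and "length \<alpha>2 = n"
    and "length p1 = n" and "length p2 = n"
    and "length \<beta>1 = n" and "length \<beta>2 = n"
    and "\<forall>i<n. \<alpha>1 ! i > 0" and "\<forall>i<n. \<alpha>2 ! i > 0"
    and "\<forall>i<n. 0 < p1 ! i \<and> p1 ! i < 1" and "\<forall>i<n. 0 < p2 ! i \<and> p2 ! i < 1"
    and "\<forall>i<n. \<beta>1 ! i > 0" and "\<forall>i<n. \<beta>2 ! i > 0"
  shows "(indep_neg_binomials M1 n N1 \<alpha>1 p1 \<and> indep_neg_binomials M2 n N2 \<alpha>2 p2 \<and>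
          (\<alpha>2, p2) =\<^sup>a (sort \<alpha>2, rev (sort p2)) \<and>
          \<alpha>1 \<prec>\<^sub>w \<alpha>2 \<and> map ln p1 \<prec>\<^sup>w map ln p2 \<longrightarrow>
          st_le M1 (\<lambda>\<omega>. real (\<Sum>i<n. N1 i \<omega>)) M2 (\<lambda>\<omega>. real (\<Sum>i<n. N2 i \<omega>)))
       \<and> (indep_gammas M3 n G1 \<alpha>1 \<beta>1 \<and> indep_gammas M4 n G2 \<alpha>2 \<beta>2 \<and>
          (\<alpha>2, \<beta>2) =\<^sup>a (sort \<alpha>2, rev (sort \<beta>2)) \<and>
          \<alpha>1 \<prec>\<^sub>w \<alpha>2 \<and> map ln \<beta>1 \<prec>\<^sup>w map ln \<beta>2 \<longrightarrow>
          st_le M3 (\<lambda>\<omega>. \<Sum>i<n. G1 i \<omega>) M4 (\<lambda>\<omega>. \<Sum>i<n. G2 i \<omega>))"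
proof (intro conjI impI; elim conjE)
  assume "indep_neg_binomials M1 n N1 \<alpha>1 p1" "indep_neg_binomials M2 n N2 \<alpha>2 p2"
    "(\<alpha>2, p2) =\<^sup>a (sort \<alpha>2, rev (sort p2))" "\<alpha>1 \<prec>\<^sub>w \<alpha>2" "map ln p1 \<prec>\<^sup>w map ln p2"
  then show "st_le M1 (\<lambda>\<omega>. real (\<Sum>i<n. N1 i \<omega>)) M2 (\<lambda>\<omega>. real (\<Sum>i<n. N2 i \<omega>))"
    using assms by (intro neg_binomial_sum_st_le[of \<alpha>1 n \<alpha>2 p1 p2]) auto
next
  assume "indep_gammas M3 n G1 \<alpha>1 \<beta>1" "indep_gammas M4 n G2 \<alpha>2 \<beta>2"
    "(\<alpha>2, \<beta>2) =\<^sup>a (sort \<alpha>2, rev (sort \<beta>2))" "\<alpha>1 \<prec>\<^sub>w \<alpha>2" "map ln \<beta>1 \<prec>\<^sup>w map ln \<beta>2"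
  then show "st_le M3 (\<lambda>\<omega>. \<Sum>i<n. G1 i \<omega>) M4 (\<lambda>\<omega>. \<Sum>i<n. G2 i \<omega>)"
    using assms by (intro gamma_sum_st_le[of \<alpha>1 n \<alpha>2 \<beta>1 \<beta>2]) auto
qed

end
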